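(* For every $\lambda\mu\mathrm{T}$-term $t$: if $t\in\mathrm{SN}_A$, then $t\in\mathrm{SN}_{AB}$.
   Context: The calculus $\lambda\mu\mathrm{T}$ (raw terms). Types: $\rho,\sigma,\tau ::= \mathbb{N} \mid \sigma\to\tau$. Over infinite sets of $\lambda$-variables $x,y,\dots$ and $\mu$-variables $\alpha,\beta,\gamma,\dots$, terms and commands are mutually defined by $t,r,s ::= x \mid \lambda x{:}\rho.r \mid t\,s \mid \mu\alpha{:}\rho.c \mid 0 \mid \mathsf{S}\,t \mid \mathsf{nrec}_\rho\ r\ s\ t$ and $c ::= [\alpha]t$. Terms are considered modulo renaming of bound variables; $FCV(t)$ = free $\mu$-variables; $t[x:=r]$ is capture-avoiding substitution. Numerals: $\underline{n} := \mathsf{S}^n 0$. Contexts: $E ::= \Box \mid E\,t \mid \mathsf{S}\,E \mid \mathsf{nrec}\ r\ s\ E$; $E[u]$ fills the hole with $u$. Structural substitution $t[\alpha:=\beta E]$ is homomorphic on all constructs (capture-avoiding) except $([\alpha]u)[\alpha:=\beta E] := [\beta]E[u[\alpha:=\beta E]]$ (and $([\gamma]u)[\alpha:=\beta E]:=[\gamma](u[\alpha:=\beta E])$ for $\gamma\neq\alpha$). $\to_A$ is the compatible closure (on terms and commands) of: $(\lambda x.t)r\to t[x:=r]$; $\mathsf{S}(\mu\alpha.c)\to\mu\alpha.c[\alpha:=\alpha(\mathsf{S}\,\Box)]$; $(\mu\alpha.c)s\to\mu\alpha.c[\alpha:=\alpha(\Box\,s)]$; $\mathsf{nrec}\ r\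 s\ 0\to r$; $\mathsf{nrec}\ r\ s\ (\mathsf{S}\,\underline{n})\to s\ \underline{n}\ (\mathsf{nrec}\ r\ s\ \underline{n})$; $\mathsf{nrec}\ r\ s\ (\mu\alpha.c)\to\mu\alpha.c[\alpha:=\alpha(\mathsf{nrec}\ r\ s\ \Box)]$. $\to_B$ is the compatible closure of $\mu\alpha.[\alpha]t\to t$ (if $\alpha\notin FCV(t)$) and $[\alpha]\mu\beta.c\to c[\beta:=\alpha\,\Box]$. $\to_{AB}:=\to_A\cup\to_B$. For $X\in\{A,AB\}$, $\mathrm{SN}_X$ is defined inductively: $t\in\mathrm{SN}_X$ whenever every $t'$ with $t\to_X t'$ is in $\mathrm{SN}_X$. *)

theory Defs
  imports Main
begin

text \<open>Raw terms of the lambda-mu-T calculus, with de Bruijn indices for both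
  lambda-variables (Var i) and mu-variables (the index in Cmd a t), so that terms are
  identified modulo renaming of bound variables.  The two kinds of indices live in
  separate index spaces.  Lam binds lambda-index 0 in its body; Mu binds mu-index 0
  in its command.\<close>

datatype ty = Nat | Arr ty ty

datatype trm =
    Var nat
  | Lam ty trm
  | App trm trm
  | Mu ty cmd
  | Zero
  | S trm
  | Nrec ty trm trm trm
and cmd = Cmd nat trm

primrec lren :: "(nat \<Rightarrow> nat) \<Rightarrow> trm \<Rightarrow> trm"
  and lren_c :: "(nat \<Rightarrow> nat) \<Rightarrow> cmd \<Rightarrow> cmd" where
  "lren f (Var i) = Var (f i)"
| "lren f (Lam T t) = Lam T (lren (\<lambda>i. case i of 0 \<Rightarrow> 0 | Suc j \<Rightarrow> Suc (f j)) t)"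
| "lren f (App t s) = App (lren f t) (lren f s)"
| "lren f (Mu T c) = Mu T (lren_c f c)"
| "lren f Zero = Zero"
| "lren f (S t) = S (lren f t)"
| "lren f (Nrec R r s t) = Nrec R (lren f r) (lren f s) (lren f t)"
| "lren_c f (Cmd a t) = Cmd a (lren f t)"

primrec mren :: "(nat \<Rightarrow> nat) \<Rightarrow> trm \<Rightarrow> trm"
  and mren_c :: "(nat \<Rightarrow> nat) \<Rightarrow> cmd \<Rightarrow> cmd" where
  "mren f (Var i) = Var i"
| "mren f (Lam T t) = Lam T (mren f t)"
| "mren f (App t s) = App (mren f t) (mren f s)"
| "mren f (Mu T c) = Mu T (mren_c (\<lambda>i. case i of 0 \<Rightarrow> 0 | Suc j \<Rightarrow> Suc (f j)) c)"
| "mren f Zero = Zero"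
| "mren f (S t) = S (mren f t)"
| "mren f (Nrec R r s t) = Nrec R (mren f r) (mren f s) (mren f t)"
| "mren_c f (Cmd a t) = Cmd (f a) (mren f t)"

primrec fmv :: "trm \<Rightarrow> nat set" and fmv_c :: "cmd \<Rightarrow> nat set" where
  "fmv (Var i) = {}"
| "fmv (Lam T t) = fmv t"
| "fmv (App t s) = fmv t \<union> fmv s"
| "fmv (Mu T c) = {j. Suc j \<in> fmv_c c}"
| "fmv Zero = {}"
| "fmv (S t) = fmv t"
| "fmv (Nrec R r s t) = fmv r \<union> fmv s \<union> fmv t"
| "fmv_c (Cmd a t) = insert a (fmv t)"

primrec subst :: "(nat \<Rightarrow> trm) \<Rightarrow> trm \<Rightarrow> trm"
  and subst_c :: "(nat \<Rightarrow> trm) \<Rightarrow> cmd \<Rightarrow> cmd" where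
  "subst \<sigma> (Var i) = \<sigma> i"
| "subst \<sigma> (Lam T t) = Lam T (subst (\<lambda>i. case i of 0 \<Rightarrow> Var 0 | Suc j \<Rightarrow> lren Suc (\<sigma> j)) t)"
| "subst \<sigma> (App t s) = App (subst \<sigma> t) (subst \<sigma> s)"
| "subst \<sigma> (Mu T c) = Mu T (subst_c (\<lambda>i. mren Suc (\<sigma> i)) c)"
| "subst \<sigma> Zero = Zero"
| "subst \<sigma> (S t) = S (subst \<sigma> t)"
| "subst \<sigma> (Nrec R r s t) = Nrec R (subst \<sigma> r) (subst \<sigma> s) (subst \<sigma> t)"
| "subst_c \<sigma> (Cmd a t) = Cmd a (subst \<sigma> t)"

definition subst1 :: "trm \<Rightarrow> trm \<Rightarrow> trm" where
  "subst1 t r = subst (\<lambda>i. case i of 0 \<Rightarrow> r | Suc j \<Rightarrow> Var j) t"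

primrec numeral_t :: "nat \<Rightarrow> trm" where
  "numeral_t 0 = Zero"
| "numeral_t (Suc n) = S (numeral_t n)"

datatype ctx = Hole | CApp ctx trm | CS ctx | CNrec ty trm trm ctx

primrec fill :: "ctx \<Rightarrow> trm \<Rightarrow> trm" where
  "fill Hole u = u"
| "fill (CApp E t) u = App (fill E u) t"
| "fill (CS E) u = S (fill E u)"
| "fill (CNrec R r s E) u = Nrec R r s (fill E u)"

primrec clren :: "(nat \<Rightarrow> nat) \<Rightarrow> ctx \<Rightarrow> ctx" where
  "clren f Hole = Hole"
| "clren f (CApp E t) = CApp (clren f E) (lren f t)"
| "clren f (CS E) = CS (clren f E)"
| "clren f (CNrec R r s E) = CNrec R (lren f r) (lren f s) (clren f E)"

primrec cmren :: "(nat \<Rightarrow> nat) \<Rightarrow> ctx \<Rightarrow> ctx" where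
  "cmren f Hole = Hole"
| "cmren f (CApp E t) = CApp (cmren f E) (mren f t)"
| "cmren f (CS E) = CS (cmren f E)"
| "cmren f (CNrec R r s E) = CNrec R (mren f r) (mren f s) (cmren f E)"

primrec ssub :: "nat \<Rightarrow> ctx \<Rightarrow> trm \<Rightarrow> trm"
  and ssub_c :: "nat \<Rightarrow> ctx \<Rightarrow> cmd \<Rightarrow> cmd" where
  "ssub k E (Var i) = Var i"
| "ssub k E (Lam T t) = Lam T (ssub k (clren Suc E) t)"
| "ssub k E (App t s) = App (ssub k E t) (ssub k E s)"
| "ssub k E (Mu T c) = Mu T (ssub_c (Suc k) (cmren Suc E) c)"
| "ssub k E Zero = Zero"
| "ssub k E (S t) = S (ssub k E t)"
| "ssub k E (Nrec R r s t) = Nrec R (ssub k E r) (ssub k E s) (ssub k E t)"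
| "ssub_c k E (Cmd a t) =
     (if a = k then Cmd a (fill E (ssub k E t)) else Cmd a (ssub k E t))"

text \<open>Codomain of an arrow type (annotation of the mu-binder after (mu a:rho.c) s).\<close>
fun cod :: "ty \<Rightarrow> ty" where
  "cod (Arr A B) = B"
| "cod Nat = Nat"

inductive headA :: "trm \<Rightarrow> trm \<Rightarrow> bool" where
  beta: "headA (App (Lam T t) r) (subst1 t r)"
| muS: "headA (S (Mu T c)) (Mu T (ssub_c 0 (CS Hole) c))"
| muApp: "headA (App (Mu T c) s) (Mu (cod T) (ssub_c 0 (CApp Hole (mren Suc s)) c))"
| nrec0: "headA (Nrec R r s Zero) r"
| nrecS: "headA (Nrec R r s (S (numeral_t n))) (App (App s (numeral_t n)) (Nrec R r s (numeral_t n)))"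
| nrecMu: "headA (Nrec R r s (Mu T c))
             (Mu R (ssub_c 0 (CNrec R (mren Suc r) (mren Suc s) Hole) c))"

inductive headB :: "trm \<Rightarrow> trm \<Rightarrow> bool" where
  muEta: "0 \<notin> fmv t \<Longrightarrow> headB (Mu T (Cmd 0 t)) (mren (\<lambda>i. i - 1) t)"

inductive headB_c :: "cmd \<Rightarrow> cmd \<Rightarrow> bool" where
  muRen: "headB_c (Cmd a (Mu T c)) (mren_c (\<lambda>i. case i of 0 \<Rightarrow> a | Suc j \<Rightarrow> j) c)"

inductive cc :: "(trm \<Rightarrow> trm \<Rightarrow> bool) \<Rightarrow> (cmd \<Rightarrow> cmd \<Rightarrow> bool) \<Rightarrow> trm \<Rightarrow> trm \<Rightarrow> bool"
  and cc_c :: "(trm \<Rightarrow> trm \<Rightarrow> bool) \<Rightarrow> (cmd \<Rightarrow> cmd \<Rightarrow> bool) \<Rightarrow> cmd \<Rightarrow> cmd \<Rightarrow> bool"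
  for R :: "trm \<Rightarrow> trm \<Rightarrow> bool" and Rc :: "cmd \<Rightarrow> cmd \<Rightarrow> bool" where
  root: "R t t' \<Longrightarrow> cc R Rc t t'"
| root_c: "Rc c c' \<Longrightarrow> cc_c R Rc c c'"
| lam: "cc R Rc t t' \<Longrightarrow> cc R Rc (Lam T t) (Lam T t')"
| appL: "cc R Rc t t' \<Longrightarrow> cc R Rc (App t s) (App t' s)"
| appR: "cc R Rc s s' \<Longrightarrow> cc R Rc (App t s) (App t s')"
| mu: "cc_c R Rc c c' \<Longrightarrow> cc R Rc (Mu T c) (Mu T c')"
| suc: "cc R Rc t t' \<Longrightarrow> cc R Rc (S t) (S t')"
| nrec1: "cc R Rc r r' \<Longrightarrow> cc R Rc (Nrec T r s t) (Nrec T r' s t)"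
| nrec2: "cc R Rc s s' \<Longrightarrow> cc R Rc (Nrec T r s t) (Nrec T r s' t)"
| nrec3: "cc R Rc t t' \<Longrightarrow> cc R Rc (Nrec T r s t) (Nrec T r s t')"
| cmd: "cc R Rc t t' \<Longrightarrow> cc_c R Rc (Cmd a t) (Cmd a t')"

definition stepA :: "trm \<Rightarrow> trm \<Rightarrow> bool" where
  "stepA = cc headA (\<lambda>_ _. False)"

definition stepAB :: "trm \<Rightarrow> trm \<Rightarrow> bool" where
  "stepAB = cc (\<lambda>t t'. headA t t' \<or> headB t t') headB_c"

inductive SN :: "(trm \<Rightarrow> trm \<Rightarrow> bool) \<Rightarrow> trm \<Rightarrow> bool" for R where
  SNI: "(\<And>t'. R t t' \<Longrightarrow> SN R t') \<Longrightarrow> SN R t"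

end

theory Submission
  imports Defs
begin

(* The proof is by postponement of B-steps:
   (1) every B-step strictly decreases the size of a term (a mu-binder disappears);
   (2) a B-step followed by an A-step can be traded for an A-step followed by AB-steps:
         t ->B t' ->A t''   implies   t ->A u ->AB* t''   for some u. *)

lemma SN_reduct: "R\<^sup>*\<^sup>* t t' \<Longrightarrow> SN R t \<Longrightarrow> SN R t'"
  by (induction rule: rtranclp_induct) (auto elim: SN.cases)

lemma SN_postponement:
  fixes A B AB :: "trm \<Rightarrow> trm \<Rightarrow> bool" and m :: "trm \<Rightarrow> nat"
  assumes split: "\<And>x y. AB x y \<Longrightarrow> A x y \<or> B x y"
    and decreasing: "\<And>x y. B x y \<Longrightarrow> m y < m x"
    and postpone: "\<And>x y z. B x y \<Longrightarrow> A y z \<Longrightarrow> \<exists>w. A x w \<and> AB\<^sup>*\<^sup>* w z"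
    and SN_A: "SN A t"
  shows "SN AB t"
proof -
  have postpone_star: "\<exists>w. A x w \<and> AB\<^sup>*\<^sup>* w z" if "B\<^sup>*\<^sup>* x y" "A y z" for x y z
    using that
  proof (induction arbitrary: z rule: converse_rtranclp_induct)
    case (step x x1)
    then obtain w1 where "A x1 w1" "AB\<^sup>*\<^sup>* w1 z" by blast
    moreover obtain w where "A x w" "AB\<^sup>*\<^sup>* w w1" using postpone[OF step(1) \<open>A x1 w1\<close>] by blast
    ultimately show ?case by (blast intro: rtranclp_trans)
  qed blast
  from SN_A show ?thesis
  proof (induction rule: SN.induct)
    case (SNI t)
    have "SN AB y" if "B\<^sup>*\<^sup>* t y" for y
      using that
    proof (induction "m y" arbitrary: y rule: less_induct)
      case less
      show ?case
      proof (rule SN.SNI)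
        fix z assume "AB y z"
        then consider "B y z" | "A y z" using split by blast
        then show "SN AB z"
        proof cases
          case 1
          then show ?thesis using less decreasing by (meson rtranclp.rtrancl_into_rtrancl)
        next
          case 2
          then obtain w where "A t w" "AB\<^sup>*\<^sup>* w z" using postpone_star less.prems by blast
          then show ?thesis using SNI.IH SN_reduct by blast
        qed
      qed
    qed
    then show ?case by blast
  qed
qed

definition lift :: "(nat \<Rightarrow> nat) \<Rightarrow> nat \<Rightarrow> nat" where
  "lift f = (\<lambda>i. case i of 0 \<Rightarrow> 0 | Suc j \<Rightarrow> Suc (f j))"

definition liftS :: "(nat \<Rightarrow> trm) \<Rightarrow> nat \<Rightarrow> trm" where
  "liftS \<sigma> = (\<lambda>i. case i of 0 \<Rightarrow> Var 0 | Suc j \<Rightarrow> lren Suc (\<sigma> j))"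

lemma lren_Lam[simp]: "lren f (Lam T t) = Lam T (lren (lift f) t)"
  by (simp add: lift_def)
lemma mren_Mu[simp]: "mren f (Mu T c) = Mu T (mren_c (lift f) c)"
  by (simp add: lift_def)
lemma subst_Lam[simp]: "subst \<sigma> (Lam T t) = Lam T (subst (liftS \<sigma>) t)"
  by (simp add: liftS_def)
declare lren.simps(2)[simp del] mren.simps(4)[simp del] subst.simps(2)[simp del]

lemma lift_0[simp]: "lift f 0 = 0" and lift_Suc[simp]: "lift f (Suc j) = Suc (f j)"
  by (simp_all add: lift_def)
lemma lift_comp[simp]: "lift f \<circ> lift g = lift (f \<circ> g)"
  by (auto simp: fun_eq_iff lift_def split: nat.split)
lemma lift_id[simp]: "lift id = id" "lift (\<lambda>a. a) = (\<lambda>a. a)"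
  by (auto simp: fun_eq_iff lift_def split: nat.split)
lemma lift_Suc_comp[simp]: "lift f \<circ> Suc = Suc \<circ> f"
  by (auto simp: fun_eq_iff)
lemma lift_eq_0: "lift f x = 0 \<longleftrightarrow> x = 0"
  by (cases x) auto

lemma mren_mren[simp]: "mren f (mren g t) = mren (f \<circ> g) t" "mren_c f (mren_c g c) = mren_c (f \<circ> g) c"
  by (induction t and c arbitrary: f g and f g) auto
lemma lren_lren[simp]: "lren f (lren g t) = lren (f \<circ> g) t" "lren_c f (lren_c g c) = lren_c (f \<circ> g) c"
  by (induction t and c arbitrary: f g and f g) auto
lemma mren_id[simp]: "mren id t = t" "mren (\<lambda>a. a) t = t" "mren_c id c = c" "mren_c (\<lambda>a. a) c = c"
  by (induction t and c) auto
lemma lren_mren: "lren f (mren g t) = mren g (lren f t)" "lren_c f (mren_c g c) = mren_c g (lren_c f c)"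
  by (induction t and c arbitrary: f g and f g) auto

lemma fmv_Mu_image: "{j. Suc j \<in> lift f ` A} = f ` {j. Suc j \<in> A}"
proof (intro set_eqI iffI)
  fix x assume "x \<in> {j. Suc j \<in> lift f ` A}"
  then obtain y where "y \<in> A" "Suc x = lift f y" by auto
  then show "x \<in> f ` {j. Suc j \<in> A}" by (cases y) auto
next
  fix x assume "x \<in> f ` {j. Suc j \<in> A}"
  then obtain y where "Suc y \<in> A" "x = f y" by auto
  then have "Suc x = lift f (Suc y)" by simp
  with \<open>Suc y \<in> A\<close> show "x \<in> {j. Suc j \<in> lift f ` A}" by blast
qed

lemma fmv_mren[simp]: "fmv (mren f t) = f ` fmv t" "fmv_c (mren_c f c) = f ` fmv_c c"
  by (induction t and c arbitrary: f and f) (auto simp: fmv_Mu_image image_Un)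
lemma fmv_lren[simp]: "fmv (lren f t) = fmv t" "fmv_c (lren_c f c) = fmv_c c"
  by (induction t and c arbitrary: f and f) auto

lemma mren_cong: "(\<And>a. a \<in> fmv t \<Longrightarrow> f a = g a) \<Longrightarrow> mren f t = mren g t"
  "(\<And>a. a \<in> fmv_c c \<Longrightarrow> f a = g a) \<Longrightarrow> mren_c f c = mren_c g c"
proof (induction t and c arbitrary: f g and f g)
  case (Mu T c)
  have "\<And>b. b \<in> fmv_c c \<Longrightarrow> lift f b = lift g b"
  proof -
    fix b assume b: "b \<in> fmv_c c" then show "lift f b = lift g b"
    proof (cases b)
      case (Suc a)
      with b have "a \<in> fmv (Mu T c)" by simp
      then have "f a = g a" by (rule Mu.prems)
      with Suc show ?thesis by simp
    qed simp
  qed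
  then have "mren_c (lift f) c = mren_c (lift g) c" by (rule Mu.IH)
  then show ?case by simp
next
  case (Lam T t)
  have "mren f t = mren g t" by (rule Lam.IH) (rule Lam.prems, simp)
  then show ?case by simp
next
  case (App t s)
  have "mren f t = mren g t" by (rule App.IH(1)) (rule App.prems, simp)
  moreover have "mren f s = mren g s" by (rule App.IH(2)) (rule App.prems, simp)
  ultimately show ?case by simp
next
  case (S t)
  have "mren f t = mren g t" by (rule S.IH) (rule S.prems, simp)
  then show ?case by simp
next
  case (Nrec R r s t)
  have "mren f r = mren g r" by (rule Nrec.IH(1)) (rule Nrec.prems, simp)
  moreover have "mren f s = mren g s" by (rule Nrec.IH(2)) (rule Nrec.prems, simp)
  moreover have "mren f t = mren g t" by (rule Nrec.IH(3)) (rule Nrec.prems, simp)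
  ultimately show ?case by simp
next
  case (Cmd a t)
  have "mren f t = mren g t" by (rule Cmd.IH) (rule Cmd.prems, simp)
  moreover have "f a = g a" by (rule Cmd.prems, simp)
  ultimately show ?case by simp
qed simp_all

lemma size_mren[simp]: "size (mren f t) = size t" "size (mren_c f c) = size c"
  by (induction t and c arbitrary: f and f) auto

lemma numeral_mren[simp]: "mren f (numeral_t n) = numeral_t n"
  by (induction n) auto
lemma numeral_lren[simp]: "lren f (numeral_t n) = numeral_t n"
  by (induction n) auto
lemma numeral_fmv[simp]: "fmv (numeral_t n) = {}"
  by (induction n) auto

lemma mren_eq_numeral: "mren f v = numeral_t n \<Longrightarrow> v = numeral_t n"
proof (induction n arbitrary: v)
  case 0 then show ?case by (cases v) auto
next
  case (Suc n) then show ?case by (cases v) auto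
qed

lemma lren_subst:
  "lren f (subst \<sigma> t) = subst (\<lambda>i. lren f (\<sigma> i)) t"
  "lren_c f (subst_c \<sigma> c) = subst_c (\<lambda>i. lren f (\<sigma> i)) c"
proof (induction t and c arbitrary: f \<sigma> and f \<sigma>)
  case (Lam T t)
  have "(\<lambda>x. lren (lift f) (liftS \<sigma> x)) = liftS (\<lambda>x. lren f (\<sigma> x))"
    by (auto simp: fun_eq_iff liftS_def split: nat.split)
  then show ?case by (simp add: Lam)
qed (auto simp: lren_mren)

lemma subst_lren:
  "subst \<sigma> (lren f t) = subst (\<lambda>i. \<sigma> (f i)) t"
  "subst_c \<sigma> (lren_c f c) = subst_c (\<lambda>i. \<sigma> (f i)) c"
proof (induction t and c arbitrary: f \<sigma> and f \<sigma>)
  case (Lam T t)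
  have "(\<lambda>x. liftS \<sigma> (lift f x)) = liftS (\<lambda>x. \<sigma> (f x))"
    by (auto simp: fun_eq_iff liftS_def split: nat.split)
  then show ?case by (simp add: Lam)
qed auto

lemma mren_subst:
  "mren f (subst \<sigma> t) = subst (\<lambda>i. mren f (\<sigma> i)) (mren f t)"
  "mren_c f (subst_c \<sigma> c) = subst_c (\<lambda>i. mren f (\<sigma> i)) (mren_c f c)"
proof (induction t and c arbitrary: f \<sigma> and f \<sigma>)
  case (Lam T t)
  have "(\<lambda>x. mren f (liftS \<sigma> x)) = liftS (\<lambda>x. mren f (\<sigma> x))"
    by (auto simp: fun_eq_iff liftS_def lren_mren split: nat.split)
  then show ?case by (simp add: Lam)
qed auto

lemma fmv_subst:
  "x \<in> fmv (subst \<sigma> t) \<Longrightarrow> x \<in> fmv t \<or> (\<exists>i. x \<in> fmv (\<sigma> i))"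
  "x \<in> fmv_c (subst_c \<sigma> c) \<Longrightarrow> x \<in> fmv_c c \<or> (\<exists>i. x \<in> fmv (\<sigma> i))"
proof (induction t and c arbitrary: x \<sigma> and x \<sigma>)
  case (Lam T t)
  then have "x \<in> fmv t \<or> (\<exists>i. x \<in> fmv (liftS \<sigma> i))" by simp
  then show ?case by (auto simp: liftS_def gr0_conv_Suc split: nat.splits)
next
  case (Mu T c)
  then have "Suc x \<in> fmv_c (subst_c (\<lambda>i. mren Suc (\<sigma> i)) c)" by simp
  then have "Suc x \<in> fmv_c c \<or> (\<exists>i. Suc x \<in> fmv (mren Suc (\<sigma> i)))" by (rule Mu.IH)
  then show ?case by auto
next
  case (App t s) then show ?case by (metis UnE UnI1 UnI2 fmv.simps(3) subst.simps(3))
next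
  case (Nrec R r s t) then show ?case by (metis UnE UnI1 UnI2 fmv.simps(7) subst.simps(7))
next
  case (Cmd a t) then show ?case by (metis fmv_c.simps insertE insertI1 insertI2 subst_c.simps)
qed auto

lemma fmv_subst1: "x \<in> fmv (subst1 t r) \<Longrightarrow> x \<in> fmv t \<or> x \<in> fmv r"
  unfolding subst1_def by (drule fmv_subst(1)) (auto simp: gr0_conv_Suc split: nat.splits)

lemma subst1_mren: "mren f (subst1 t r) = subst1 (mren f t) (mren f r)"
  unfolding subst1_def mren_subst by (rule arg_cong[where f = "\<lambda>\<sigma>. subst \<sigma> _"]) (auto split: nat.split)
lemma subst1_lren: "lren f (subst1 t r) = subst1 (lren (lift f) t) (lren f r)"
  unfolding subst1_def lren_subst subst_lren by (rule arg_cong[where f = "\<lambda>\<sigma>. subst \<sigma> _"]) (auto split: nat.split)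

primrec fmvx :: "ctx \<Rightarrow> nat set" where
  "fmvx Hole = {}"
| "fmvx (CApp E t) = fmvx E \<union> fmv t"
| "fmvx (CS E) = fmvx E"
| "fmvx (CNrec R r s E) = fmv r \<union> fmv s \<union> fmvx E"

primrec cfill :: "ctx \<Rightarrow> ctx \<Rightarrow> ctx" where
  "cfill Hole G = G"
| "cfill (CApp F t) G = CApp (cfill F G) t"
| "cfill (CS F) G = CS (cfill F G)"
| "cfill (CNrec R r s F) G = CNrec R r s (cfill F G)"

lemma fill_cfill[simp]: "fill (cfill F G) u = fill F (fill G u)" by (induction F) auto
lemma mren_fill[simp]: "mren f (fill E u) = fill (cmren f E) (mren f u)" by (induction E) auto
lemma lren_fill[simp]: "lren f (fill E u) = fill (clren f E) (lren f u)" by (induction E) auto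
lemma fmv_fill[simp]: "fmv (fill E u) = fmvx E \<union> fmv u" by (induction E) auto
lemma cmren_cmren[simp]: "cmren f (cmren g E) = cmren (f \<circ> g) E" by (induction E) (auto simp: comp_def)
lemma clren_clren[simp]: "clren f (clren g E) = clren (f \<circ> g) E" by (induction E) (auto simp: comp_def)
lemma cmren_id[simp]: "cmren id E = E" "cmren (\<lambda>a. a) E = E" by (induction E) auto
lemma cmren_clren[simp]: "cmren f (clren g E) = clren g (cmren f E)" by (induction E) (auto simp: lren_mren)
lemma fmvx_cmren[simp]: "fmvx (cmren f E) = f ` fmvx E" by (induction E) (auto simp: image_Un)
lemma fmvx_clren[simp]: "fmvx (clren f E) = fmvx E" by (induction E) auto
lemma cmren_cfill[simp]: "cmren f (cfill F G) = cfill (cmren f F) (cmren f G)" by (induction F) auto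
lemma clren_cfill[simp]: "clren f (cfill F G) = cfill (clren f F) (clren f G)" by (induction F) auto

text \<open>The frozen ssub is the case K = {k}; the set version is needed to
  merge two consecutive structural substitutions on different variables (ssubS_merge).\<close>

primrec ssubS :: "nat set \<Rightarrow> ctx \<Rightarrow> trm \<Rightarrow> trm"
  and ssubS_c :: "nat set \<Rightarrow> ctx \<Rightarrow> cmd \<Rightarrow> cmd" where
  "ssubS K E (Var i) = Var i"
| "ssubS K E (Lam T t) = Lam T (ssubS K (clren Suc E) t)"
| "ssubS K E (App t s) = App (ssubS K E t) (ssubS K E s)"
| "ssubS K E (Mu T c) = Mu T (ssubS_c (Suc ` K) (cmren Suc E) c)"
| "ssubS K E Zero = Zero"
| "ssubS K E (S t) = S (ssubS K E t)"
| "ssubS K E (Nrec R r s t) = Nrec R (ssubS K E r) (ssubS K E s) (ssubS K E t)"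
| "ssubS_c K E (Cmd a t) =
     (if a \<in> K then Cmd a (fill E (ssubS K E t)) else Cmd a (ssubS K E t))"

primrec cssubS :: "nat set \<Rightarrow> ctx \<Rightarrow> ctx \<Rightarrow> ctx" where
  "cssubS K F Hole = Hole"
| "cssubS K F (CApp E t) = CApp (cssubS K F E) (ssubS K F t)"
| "cssubS K F (CS E) = CS (cssubS K F E)"
| "cssubS K F (CNrec R r s E) = CNrec R (ssubS K F r) (ssubS K F s) (cssubS K F E)"

lemma ssub_ssubS: "ssub k E t = ssubS {k} E t" "ssub_c k E c = ssubS_c {k} E c"
  by (induction t and c arbitrary: k E and k E) auto

lemma ssubS_fill: "ssubS K F (fill G u) = fill (cssubS K F G) (ssubS K F u)"
  by (induction G) auto

lemma ssubS_Hole[simp]: "ssubS K Hole t = t" "ssubS_c K Hole c = c"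
  by (induction t and c arbitrary: K and K) auto

lemma ssubS_fresh:
  "K \<inter> fmv t = {} \<Longrightarrow> ssubS K E t = t"
  "K \<inter> fmv_c c = {} \<Longrightarrow> ssubS_c K E c = c"
proof (induction t and c arbitrary: K E and K E)
  case (Mu T c)
  have "Suc ` K \<inter> fmv_c c = {}" using Mu.prems by auto
  then show ?case using Mu.IH by simp
next
  case (App t s)
  have "K \<inter> fmv t = {}" "K \<inter> fmv s = {}" using App.prems by auto
  then show ?case using App.IH by simp
next
  case (Nrec R r s t)
  have "K \<inter> fmv r = {}" "K \<inter> fmv s = {}" "K \<inter> fmv t = {}" using Nrec.prems by auto
  then show ?case using Nrec.IH by simp
next
  case (Cmd a t)
  have "K \<inter> fmv t = {}" "a \<notin> K" using Cmd.prems by auto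
  then show ?case using Cmd.IH by simp
qed auto

lemma cssubS_fresh: "K \<inter> fmvx G = {} \<Longrightarrow> cssubS K F G = G"
  by (induction G) (auto simp: ssubS_fresh Int_Un_distrib)

lemma fmv_ssubS:
  "x \<in> fmv (ssubS K E t) \<Longrightarrow> x \<in> fmv t \<or> x \<in> fmvx E"
  "x \<in> fmv_c (ssubS_c K E c) \<Longrightarrow> x \<in> fmv_c c \<or> x \<in> fmvx E"
proof (induction t and c arbitrary: x K E and x K E)
  case (Lam T t) then show ?case using Lam.IH[of x K "clren Suc E"] by simp
next
  case (Mu T c)
  then have "Suc x \<in> fmv_c (ssubS_c (Suc ` K) (cmren Suc E) c)" by simp
  then have "Suc x \<in> fmv_c c \<or> Suc x \<in> fmvx (cmren Suc E)" by (rule Mu.IH)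
  then show ?case by auto
next
  case (App t s) then show ?case by (metis UnE UnI1 UnI2 fmv.simps(3) ssubS.simps(3))
next
  case (Nrec R r s t) then show ?case by (metis UnE UnI1 UnI2 fmv.simps(7) ssubS.simps(7))
next
  case (S t) then show ?case by simp
next
  case (Cmd a t) then show ?case by (auto split: if_splits)
qed auto

lemma lren_ssubS:
  "lren f (ssubS K E t) = ssubS K (clren f E) (lren f t)"
  "lren_c f (ssubS_c K E c) = ssubS_c K (clren f E) (lren_c f c)"
proof (induction t and c arbitrary: f K E and f K E)
  case (Lam T t) then show ?case by (simp add: lift_Suc_comp[symmetric] del: lift_Suc_comp)
qed (auto simp: ssubS_fill)

lemma mren_ssubS: "(\<forall>a\<in>fmv t. a \<in> K \<longleftrightarrow> f a \<in> K') \<Longrightarrow> mren f (ssubS K E t) = ssubS K' (cmren f E) (mren f t)"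
  "(\<forall>a\<in>fmv_c c. a \<in> K \<longleftrightarrow> f a \<in> K') \<Longrightarrow> mren_c f (ssubS_c K E c) = ssubS_c K' (cmren f E) (mren_c f c)"
proof (induction t and c arbitrary: f K K' E and f K K' E)
  case (Lam T t)
  have "mren f (ssubS K (clren Suc E) t) = ssubS K' (cmren f (clren Suc E)) (mren f t)"
    by (rule Lam.IH) (use Lam.prems in simp)
  then show ?case by simp
next
  case (Mu T c)
  have "\<forall>a\<in>fmv_c c. a \<in> Suc ` K \<longleftrightarrow> lift f a \<in> Suc ` K'"
  proof
    fix a assume a: "a \<in> fmv_c c"
    show "a \<in> Suc ` K \<longleftrightarrow> lift f a \<in> Suc ` K'"
    proof (cases a)
      case (Suc b)
      with a have "b \<in> fmv (Mu T c)" by simp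
      with Mu.prems have "b \<in> K \<longleftrightarrow> f b \<in> K'" by blast
      with Suc show ?thesis by auto
    qed auto
  qed
  then have "mren_c (lift f) (ssubS_c (Suc ` K) (cmren Suc E) c) = ssubS_c (Suc ` K') (cmren (lift f) (cmren Suc E)) (mren_c (lift f) c)"
    by (rule Mu.IH)
  then show ?case by simp
next
  case (App t s)
  have "mren f (ssubS K E t) = ssubS K' (cmren f E) (mren f t)"
    by (rule App.IH(1)) (use App.prems in simp)
  moreover have "mren f (ssubS K E s) = ssubS K' (cmren f E) (mren f s)"
    by (rule App.IH(2)) (use App.prems in simp)
  ultimately show ?case by simp
next
  case (S t)
  have "mren f (ssubS K E t) = ssubS K' (cmren f E) (mren f t)"
    by (rule S.IH) (use S.prems in simp)
  then show ?case by simp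
next
  case (Nrec R r s t)
  have "mren f (ssubS K E r) = ssubS K' (cmren f E) (mren f r)"
    by (rule Nrec.IH(1)) (use Nrec.prems in simp)
  moreover have "mren f (ssubS K E s) = ssubS K' (cmren f E) (mren f s)"
    by (rule Nrec.IH(2)) (use Nrec.prems in simp)
  moreover have "mren f (ssubS K E t) = ssubS K' (cmren f E) (mren f t)"
    by (rule Nrec.IH(3)) (use Nrec.prems in simp)
  ultimately show ?case by simp
next
  case (Cmd a t)
  have "mren f (ssubS K E t) = ssubS K' (cmren f E) (mren f t)"
    by (rule Cmd.IH) (use Cmd.prems in simp)
  moreover have "a \<in> K \<longleftrightarrow> f a \<in> K'" using Cmd.prems by simp
  ultimately show ?case by simp
qed auto

lemma ssubS_comp: "K \<inter> fmvx G = {} \<Longrightarrow> ssubS K F (ssubS K G t) = ssubS K (cfill F G) t"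
  "K \<inter> fmvx G = {} \<Longrightarrow> ssubS_c K F (ssubS_c K G c) = ssubS_c K (cfill F G) c"
proof (induction t and c arbitrary: K F G and K F G)
  case (Lam T t)
  have "K \<inter> fmvx (clren Suc G) = {}" using Lam.prems by simp
  then show ?case using Lam.IH by simp
next
  case (Mu T c)
  have "Suc ` K \<inter> fmvx (cmren Suc G) = {}" using Mu.prems by auto
  then show ?case using Mu.IH by simp
next
  case (Cmd a t)
  then show ?case by (simp add: ssubS_fill cssubS_fresh)
qed auto

lemma ssubS_merge: "K1 \<inter> K2 = {} \<Longrightarrow> K1 \<inter> fmvx E = {} \<Longrightarrow> ssubS K1 E (ssubS K2 E t) = ssubS (K1 \<union> K2) E t"
  "K1 \<inter> K2 = {} \<Longrightarrow> K1 \<inter> fmvx E = {} \<Longrightarrow> ssubS_c K1 E (ssubS_c K2 E c) = ssubS_c (K1 \<union> K2) E c"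
proof (induction t and c arbitrary: K1 K2 E and K1 K2 E)
  case (Lam T t)
  have "K1 \<inter> fmvx (clren Suc E) = {}" using Lam.prems by simp
  then show ?case using Lam.IH Lam.prems by simp
next
  case (Mu T c)
  have "Suc ` K1 \<inter> fmvx (cmren Suc E) = {}" "Suc ` K1 \<inter> Suc ` K2 = {}" using Mu.prems by auto
  then show ?case using Mu.IH by (simp add: image_Un)
next
  case (Cmd a t)
  then show ?case by (auto simp: ssubS_fill cssubS_fresh)
qed auto

abbreviation redA :: "trm \<Rightarrow> trm \<Rightarrow> bool" where "redA \<equiv> cc headA (\<lambda>_ _. False)"
abbreviation redA_c :: "cmd \<Rightarrow> cmd \<Rightarrow> bool" where "redA_c \<equiv> cc_c headA (\<lambda>_ _. False)"
abbreviation redB :: "trm \<Rightarrow> trm \<Rightarrow> bool" where "redB \<equiv> cc headB headB_c"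
abbreviation redB_c :: "cmd \<Rightarrow> cmd \<Rightarrow> bool" where "redB_c \<equiv> cc_c headB headB_c"
abbreviation headAB :: "trm \<Rightarrow> trm \<Rightarrow> bool" where "headAB \<equiv> (\<lambda>t t'. headA t t' \<or> headB t t')"
abbreviation redAB :: "trm \<Rightarrow> trm \<Rightarrow> bool" where "redAB \<equiv> cc headAB headB_c"
abbreviation redAB_c :: "cmd \<Rightarrow> cmd \<Rightarrow> bool" where "redAB_c \<equiv> cc_c headAB headB_c"

lemma cc_mono: "cc R Rc t t' \<Longrightarrow> (\<And>x y. R x y \<Longrightarrow> R' x y) \<Longrightarrow> (\<And>x y. Rc x y \<Longrightarrow> Rc' x y) \<Longrightarrow> cc R' Rc' t t'"
  "cc_c R Rc c c' \<Longrightarrow> (\<And>x y. R x y \<Longrightarrow> R' x y) \<Longrightarrow> (\<And>x y. Rc x y \<Longrightarrow> Rc' x y) \<Longrightarrow> cc_c R' Rc' c c'"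
  by (induction rule: cc_cc_c.inducts) (auto intro: cc_cc_c.intros)

lemma A_AB: "redA t t' \<Longrightarrow> redAB t t'" by (erule cc_mono) auto
lemma B_AB: "redB t t' \<Longrightarrow> redAB t t'" by (erule cc_mono) auto
lemma Bc_ABc: "redB_c t t' \<Longrightarrow> redAB_c t t'" by (erule cc_mono(2)) auto

lemma AB_cases: "cc R Rc t t' \<Longrightarrow> R = headAB \<Longrightarrow> Rc = headB_c \<Longrightarrow> redA t t' \<or> redB t t'"
  "cc_c R Rc c c' \<Longrightarrow> R = headAB \<Longrightarrow> Rc = headB_c \<Longrightarrow> redA_c c c' \<or> redB_c c c'"
  by (induction rule: cc_cc_c.inducts) (auto intro: cc_cc_c.intros)

lemma rtranclp_lift: "R\<^sup>*\<^sup>* x y \<Longrightarrow> (\<And>x y. R x y \<Longrightarrow> Q (f x) (f y)) \<Longrightarrow> Q\<^sup>*\<^sup>* (f x) (f y)"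
  by (induction rule: rtranclp_induct) (auto intro: rtranclp.rtrancl_into_rtrancl)

lemma AB_lam: "redAB\<^sup>*\<^sup>* t t' \<Longrightarrow> redAB\<^sup>*\<^sup>* (Lam T t) (Lam T t')"
  by (erule rtranclp_lift) (rule cc_cc_c.lam)
lemma AB_appL: "redAB\<^sup>*\<^sup>* t t' \<Longrightarrow> redAB\<^sup>*\<^sup>* (App t s) (App t' s)"
  by (erule rtranclp_lift) (rule cc_cc_c.appL)
lemma AB_appR: "redAB\<^sup>*\<^sup>* s s' \<Longrightarrow> redAB\<^sup>*\<^sup>* (App t s) (App t s')"
  by (erule rtranclp_lift) (rule cc_cc_c.appR)
lemma AB_mu: "redAB_c\<^sup>*\<^sup>* c c' \<Longrightarrow> redAB\<^sup>*\<^sup>* (Mu T c) (Mu T c')"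
  by (erule rtranclp_lift) (rule cc_cc_c.mu)
lemma AB_suc: "redAB\<^sup>*\<^sup>* t t' \<Longrightarrow> redAB\<^sup>*\<^sup>* (S t) (S t')"
  by (erule rtranclp_lift) (rule cc_cc_c.suc)
lemma AB_nrec1: "redAB\<^sup>*\<^sup>* r r' \<Longrightarrow> redAB\<^sup>*\<^sup>* (Nrec R r s t) (Nrec R r' s t)"
  by (erule rtranclp_lift) (rule cc_cc_c.nrec1)
lemma AB_nrec2: "redAB\<^sup>*\<^sup>* s s' \<Longrightarrow> redAB\<^sup>*\<^sup>* (Nrec R r s t) (Nrec R r s' t)"
  by (erule rtranclp_lift) (rule cc_cc_c.nrec2)
lemma AB_nrec3: "redAB\<^sup>*\<^sup>* t t' \<Longrightarrow> redAB\<^sup>*\<^sup>* (Nrec R r s t) (Nrec R r s t')"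
  by (erule rtranclp_lift) (rule cc_cc_c.nrec3)
lemma AB_cmd: "redAB\<^sup>*\<^sup>* t t' \<Longrightarrow> redAB_c\<^sup>*\<^sup>* (Cmd a t) (Cmd a t')"
  by (erule rtranclp_lift) (rule cc_cc_c.cmd)

lemma AB_app: "redAB\<^sup>*\<^sup>* t t' \<Longrightarrow> redAB\<^sup>*\<^sup>* s s' \<Longrightarrow> redAB\<^sup>*\<^sup>* (App t s) (App t' s')"
  by (rule rtranclp_trans[OF AB_appL AB_appR])
lemma AB_nrec: "redAB\<^sup>*\<^sup>* r r' \<Longrightarrow> redAB\<^sup>*\<^sup>* s s' \<Longrightarrow> redAB\<^sup>*\<^sup>* t t' \<Longrightarrow> redAB\<^sup>*\<^sup>* (Nrec R r s t) (Nrec R r' s' t')"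
  by (rule rtranclp_trans[OF AB_nrec1 rtranclp_trans[OF AB_nrec2 AB_nrec3]])

lemma AB_fill: "redAB\<^sup>*\<^sup>* u u' \<Longrightarrow> redAB\<^sup>*\<^sup>* (fill E u) (fill E u')"
  by (induction E) (auto intro: AB_appL AB_suc AB_nrec3)

lemma lren_ssub0: "lren_c f (ssub_c k E c) = ssub_c k (clren f E) (lren_c f c)"
  by (simp add: ssub_ssubS lren_ssubS)
lemma mren_ssub0: "mren_c (lift f) (ssub_c 0 E c) = ssub_c 0 (cmren (lift f) E) (mren_c (lift f) c)"
  unfolding ssub_ssubS by (rule mren_ssubS) (auto simp: lift_eq_0)

lemma headA_lren: "headA t t' \<Longrightarrow> headA (lren f t) (lren f t')"
proof (induction rule: headA.induct)
  case (beta T t r) then show ?case using headA.beta by (simp add: subst1_lren)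
next
  case (muS T c) then show ?case using headA.muS by (simp add: lren_ssub0)
next
  case (muApp T c s) then show ?case using headA.muApp[of T "lren_c f c" "lren f s"] by (simp add: lren_ssub0 lren_mren)
next
  case (nrec0 R r s) then show ?case using headA.nrec0 by simp
next
  case (nrecS R r s n) then show ?case using headA.nrecS by simp
next
  case (nrecMu R r s T c) then show ?case using headA.nrecMu[of R "lren f r" "lren f s" T "lren_c f c"] by (simp add: lren_ssub0 lren_mren)
qed

lemma headA_mren: "headA t t' \<Longrightarrow> headA (mren f t) (mren f t')"
proof (induction rule: headA.induct)
  case (beta T t r) then show ?case using headA.beta by (simp add: subst1_mren)
next
  case (muS T c) then show ?case using headA.muS by (simp add: mren_ssub0)
next
  case (muApp T c s) then show ?case using headA.muApp[of T "mren_c (lift f) c" "mren f s"] by (simp add: mren_ssub0)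
next
  case (nrec0 R r s) then show ?case using headA.nrec0 by simp
next
  case (nrecS R r s n) then show ?case using headA.nrecS by simp
next
  case (nrecMu R r s T c) then show ?case using headA.nrecMu[of R "mren f r" "mren f s" T "mren_c (lift f) c"] by (simp add: mren_ssub0)
qed

lemma headB_lren: "headB t t' \<Longrightarrow> headB (lren f t) (lren f t')"
proof (induction rule: headB.induct)
  case (muEta t T)
  then show ?case using headB.muEta[of "lren f t" T] by (simp add: lren_mren)
qed
lemma headBc_lren: "headB_c c c' \<Longrightarrow> headB_c (lren_c f c) (lren_c f c')"
  by (induction rule: headB_c.induct) (simp add: lren_mren headB_c.muRen)

lemma headB_mren: "headB t t' \<Longrightarrow> headB (mren f t) (mren f t')"
proof (induction rule: headB.induct)
  case (muEta t T)
  have "0 \<notin> fmv (mren (lift f) t)" using muEta by (auto simp: lift_eq_0)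
  then have "headB (Mu T (Cmd 0 (mren (lift f) t))) (mren (\<lambda>i. i - 1) (mren (lift f) t))"
    by (rule headB.muEta)
  moreover have "mren (\<lambda>i. i - 1) (mren (lift f) t) = mren f (mren (\<lambda>i. i - 1) t)"
    unfolding mren_mren
  proof (rule mren_cong)
    fix a assume a: "a \<in> fmv t"
    have "a \<noteq> (0::nat)" using muEta(1) a by (metis)
    then show "((\<lambda>i. i - 1) \<circ> lift f) a = (f \<circ> (\<lambda>i. i - 1)) a" by (cases a) auto
  qed
  ultimately show ?case by simp
qed

lemma headBc_mren: "headB_c c c' \<Longrightarrow> headB_c (mren_c f c) (mren_c f c')"
proof (induction rule: headB_c.induct)
  case (muRen a T c)
  have "headB_c (Cmd (f a) (Mu T (mren_c (lift f) c))) (mren_c (\<lambda>i. case i of 0 \<Rightarrow> f a | Suc j \<Rightarrow> j) (mren_c (lift f) c))"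
    by (rule headB_c.muRen)
  moreover have "(\<lambda>i. case i of 0 \<Rightarrow> f a | Suc j \<Rightarrow> j) \<circ> lift f = f \<circ> (\<lambda>i. case i of 0 \<Rightarrow> a | Suc j \<Rightarrow> j)"
    by (auto simp: fun_eq_iff split: nat.split)
  ultimately show ?case by simp
qed

lemma cc_lren: "cc R Rc t t' \<Longrightarrow> (\<And>f x y. R x y \<Longrightarrow> R (lren f x) (lren f y)) \<Longrightarrow> (\<And>f x y. Rc x y \<Longrightarrow> Rc (lren_c f x) (lren_c f y)) \<Longrightarrow> cc R Rc (lren f t) (lren f t')"
  "cc_c R Rc c c' \<Longrightarrow> (\<And>f x y. R x y \<Longrightarrow> R (lren f x) (lren f y)) \<Longrightarrow> (\<And>f x y. Rc x y \<Longrightarrow> Rc (lren_c f x) (lren_c f y)) \<Longrightarrow> cc_c R Rc (lren_c f c) (lren_c f c')"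
  by (induction arbitrary: f and f rule: cc_cc_c.inducts) (auto intro: cc_cc_c.intros)

lemma cc_mren: "cc R Rc t t' \<Longrightarrow> (\<And>f x y. R x y \<Longrightarrow> R (mren f x) (mren f y)) \<Longrightarrow> (\<And>f x y. Rc x y \<Longrightarrow> Rc (mren_c f x) (mren_c f y)) \<Longrightarrow> cc R Rc (mren f t) (mren f t')"
  "cc_c R Rc c c' \<Longrightarrow> (\<And>f x y. R x y \<Longrightarrow> R (mren f x) (mren f y)) \<Longrightarrow> (\<And>f x y. Rc x y \<Longrightarrow> Rc (mren_c f x) (mren_c f y)) \<Longrightarrow> cc_c R Rc (mren_c f c) (mren_c f c')"
  by (induction arbitrary: f and f rule: cc_cc_c.inducts) (auto intro: cc_cc_c.intros)

lemma AB_lren1: "redAB t t' \<Longrightarrow> redAB (lren f t) (lren f t')"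
  by (rule cc_lren) (auto intro: headA_lren headB_lren headBc_lren)
lemma AB_mren1: "redAB t t' \<Longrightarrow> redAB (mren f t) (mren f t')"
  by (rule cc_mren) (auto intro: headA_mren headB_mren headBc_mren)
lemma AB_lren: "redAB\<^sup>*\<^sup>* t t' \<Longrightarrow> redAB\<^sup>*\<^sup>* (lren f t) (lren f t')"
  by (erule rtranclp_lift) (rule AB_lren1)
lemma AB_mren: "redAB\<^sup>*\<^sup>* t t' \<Longrightarrow> redAB\<^sup>*\<^sup>* (mren f t) (mren f t')"
  by (erule rtranclp_lift) (rule AB_mren1)

lemma pred_Suc_comp[simp]: "(\<lambda>i. i - Suc 0) \<circ> Suc = id" "(\<lambda>i. i - 1) \<circ> Suc = id"
  by (auto simp: fun_eq_iff)
lemma h_Suc_comp[simp]: "(\<lambda>i. case i of 0 \<Rightarrow> a | Suc j \<Rightarrow> j) \<circ> Suc = id"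
  by (auto simp: fun_eq_iff)

lemma headB_subst: "headB t t' \<Longrightarrow> headB (subst \<sigma> t) (subst \<sigma> t')"
proof (induction rule: headB.induct)
  case (muEta v T)
  have "0 \<notin> fmv (subst (\<lambda>i. mren Suc (\<sigma> i)) v)"
  proof
    assume "0 \<in> fmv (subst (\<lambda>i. mren Suc (\<sigma> i)) v)"
    then have "0 \<in> fmv v \<or> (\<exists>i. 0 \<in> fmv (mren Suc (\<sigma> i)))" by (rule fmv_subst)
    with muEta show False by auto
  qed
  then have "headB (Mu T (Cmd 0 (subst (\<lambda>i. mren Suc (\<sigma> i)) v))) (mren (\<lambda>i. i - 1) (subst (\<lambda>i. mren Suc (\<sigma> i)) v))"
    by (rule headB.muEta)
  then show ?case by (simp add: mren_subst)
qed

lemma headBc_subst: "headB_c c c' \<Longrightarrow> headB_c (subst_c \<sigma> c) (subst_c \<sigma> c')"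
proof (induction rule: headB_c.induct)
  case (muRen a T d)
  have "headB_c (Cmd a (Mu T (subst_c (\<lambda>i. mren Suc (\<sigma> i)) d))) (mren_c (\<lambda>i. case i of 0 \<Rightarrow> a | Suc j \<Rightarrow> j) (subst_c (\<lambda>i. mren Suc (\<sigma> i)) d))"
    by (rule headB_c.muRen)
  then show ?case by (simp add: mren_subst)
qed

lemma B_subst: "cc R Rc t t' \<Longrightarrow> R = headB \<Longrightarrow> Rc = headB_c \<Longrightarrow> redB (subst \<sigma> t) (subst \<sigma> t')"
  "cc_c R Rc c c' \<Longrightarrow> R = headB \<Longrightarrow> Rc = headB_c \<Longrightarrow> redB_c (subst_c \<sigma> c) (subst_c \<sigma> c')"
  by (induction arbitrary: \<sigma> and \<sigma> rule: cc_cc_c.inducts)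
     (auto intro: cc_cc_c.intros headB_subst headBc_subst)

lemma AB_subst: "(\<And>i. redAB\<^sup>*\<^sup>* (\<sigma> i) (\<tau> i)) \<Longrightarrow> redAB\<^sup>*\<^sup>* (subst \<sigma> t) (subst \<tau> t)"
  "(\<And>i. redAB\<^sup>*\<^sup>* (\<sigma> i) (\<tau> i)) \<Longrightarrow> redAB_c\<^sup>*\<^sup>* (subst_c \<sigma> c) (subst_c \<tau> c)"
proof (induction t and c arbitrary: \<sigma> \<tau> and \<sigma> \<tau>)
  case (Lam T t)
  have "\<And>i. redAB\<^sup>*\<^sup>* (liftS \<sigma> i) (liftS \<tau> i)"
  proof -
    fix i show "redAB\<^sup>*\<^sup>* (liftS \<sigma> i) (liftS \<tau> i)"
      by (cases i) (auto simp: liftS_def intro: AB_lren Lam.prems)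
  qed
  then show ?case by (simp add: Lam.IH AB_lam)
next
  case (Mu T c)
  have "\<And>i. redAB\<^sup>*\<^sup>* (mren Suc (\<sigma> i)) (mren Suc (\<tau> i))" by (rule AB_mren) (rule Mu.prems)
  then show ?case by (simp add: Mu.IH AB_mu)
next
  case (App t s) then show ?case by (simp add: AB_app)
next
  case (S t) then show ?case by (simp add: AB_suc)
next
  case (Nrec R r s t) then show ?case by (simp add: AB_nrec)
next
  case (Cmd a t) then show ?case by (simp add: AB_cmd)
qed auto

lemma mren_eq_App: "mren f u = App a b \<longleftrightarrow> (\<exists>u1 u2. u = App u1 u2 \<and> mren f u1 = a \<and> mren f u2 = b)"
  by (cases u) auto
lemma mren_eq_Lam: "mren f u = Lam T a \<longleftrightarrow> (\<exists>u1. u = Lam T u1 \<and> mren f u1 = a)"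
  by (cases u) auto
lemma mren_eq_Mu: "mren f u = Mu T c \<longleftrightarrow> (\<exists>c1. u = Mu T c1 \<and> mren_c (lift f) c1 = c)"
  by (cases u) auto
lemma mren_eq_S: "mren f u = S a \<longleftrightarrow> (\<exists>u1. u = S u1 \<and> mren f u1 = a)"
  by (cases u) auto
lemma mren_eq_Zero: "mren f u = Zero \<longleftrightarrow> u = Zero"
  by (cases u) auto
lemma mren_eq_Nrec: "mren f u = Nrec R a b d \<longleftrightarrow> (\<exists>u1 u2 u3. u = Nrec R u1 u2 u3 \<and> mren f u1 = a \<and> mren f u2 = b \<and> mren f u3 = d)"
  by (cases u) auto
lemma mren_eq_Cmd: "mren_c f u = Cmd x a \<longleftrightarrow> (\<exists>y u1. u = Cmd y u1 \<and> f y = x \<and> mren f u1 = a)"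
  by (cases u) auto
lemmas mren_eqs = mren_eq_App mren_eq_Lam mren_eq_Mu mren_eq_S mren_eq_Zero mren_eq_Nrec mren_eq_Cmd

text \<open>A-steps are reflected by mu-renamings: every A-step out of a renamed term is the
  renaming of an A-step.  This is what makes the mu-eta B-rule commute with A-steps.\<close>

lemma headA_reflect: "headA x w \<Longrightarrow> mren f u = x \<Longrightarrow> \<exists>u'. headA u u' \<and> w = mren f u'"
proof (induction rule: headA.induct)
  case (beta T t r)
  then obtain t0 r0 where u: "u = App (Lam T t0) r0" "t = mren f t0" "r = mren f r0"
    by (auto simp: mren_eqs)
  then show ?case by (auto simp: subst1_mren intro!: headA.beta)
next
  case (muS T c)
  then obtain c0 where u: "u = S (Mu T c0)" "c = mren_c (lift f) c0"
    by (auto simp: mren_eqs)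
  then show ?case by (auto simp: mren_ssub0 intro!: headA.muS)
next
  case (muApp T c s)
  then obtain c0 s0 where u: "u = App (Mu T c0) s0" "c = mren_c (lift f) c0" "s = mren f s0"
    by (auto simp: mren_eqs)
  then show ?case by (auto simp: mren_ssub0 intro!: headA.muApp)
next
  case (nrec0 R r s)
  then obtain r0 s0 where u: "u = Nrec R r0 s0 Zero" "r = mren f r0"
    by (auto simp: mren_eqs)
  then show ?case by (auto intro!: headA.nrec0)
next
  case (nrecS R r s n)
  then obtain r0 s0 v where u: "u = Nrec R r0 s0 (S v)" "r = mren f r0" "s = mren f s0" "mren f v = numeral_t n"
    by (auto simp: mren_eqs)
  then have "v = numeral_t n" by (simp add: mren_eq_numeral)
  with u show ?case by (auto intro!: headA.nrecS)
next
  case (nrecMu R r s T c)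
  then obtain r0 s0 c0 where u: "u = Nrec R r0 s0 (Mu T c0)" "r = mren f r0" "s = mren f s0" "c = mren_c (lift f) c0"
    by (auto simp: mren_eqs)
  then show ?case by (auto simp: mren_ssub0 intro!: headA.nrecMu)
qed

lemma A_reflect:
  "cc R Rc x w \<Longrightarrow> R = headA \<Longrightarrow> Rc = (\<lambda>_ _. False) \<Longrightarrow> mren f u = x \<Longrightarrow> \<exists>u'. redA u u' \<and> w = mren f u'"
  "cc_c R Rc c d \<Longrightarrow> R = headA \<Longrightarrow> Rc = (\<lambda>_ _. False) \<Longrightarrow> mren_c f c0 = c \<Longrightarrow> \<exists>c'. redA_c c0 c' \<and> d = mren_c f c'"
proof (induction arbitrary: f u and f c0 rule: cc_cc_c.inducts)
  case (root t t')
  then obtain u' where "headA u u'" "t' = mren f u'" using headA_reflect by blast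
  then show ?case by (auto intro: cc_cc_c.root)
qed (fastforce simp: mren_eqs intro: cc_cc_c.intros)+

lemma fmv_Mu_ssub0: "y \<in> fmv_c (ssub_c k F c) \<Longrightarrow> y \<in> fmv_c c \<or> y \<in> fmvx F"
  unfolding ssub_ssubS by (rule fmv_ssubS(2))

lemma headA_fmv: "headA t t' \<Longrightarrow> x \<in> fmv t' \<Longrightarrow> x \<in> fmv t"
  by (induction rule: headA.induct) (auto dest: fmv_subst1 fmv_Mu_ssub0)

lemma A_fmv: "cc R Rc t t' \<Longrightarrow> R = headA \<Longrightarrow> Rc = (\<lambda>_ _. False) \<Longrightarrow> x \<in> fmv t' \<Longrightarrow> x \<in> fmv t"
  "cc_c R Rc c c' \<Longrightarrow> R = headA \<Longrightarrow> Rc = (\<lambda>_ _. False) \<Longrightarrow> x \<in> fmv_c c' \<Longrightarrow> x \<in> fmv_c c"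
  by (induction arbitrary: x and x rule: cc_cc_c.inducts) (auto dest: headA_fmv)

text \<open>B-steps strictly decrease the size of a term: both B-rules erase a mu-binder.\<close>

lemma B_size:
  "cc R Rc t t' \<Longrightarrow> R = headB \<Longrightarrow> Rc = headB_c \<Longrightarrow> size t' < size t"
  "cc_c R Rc c c' \<Longrightarrow> R = headB \<Longrightarrow> Rc = headB_c \<Longrightarrow> size c' < size c"
  by (induction rule: cc_cc_c.inducts) (auto elim: headB.cases headB_c.cases)

inductive layer :: "ctx \<Rightarrow> bool" where
  "layer (CS Hole)" | "layer (CApp Hole s)" | "layer (CNrec R r s Hole)"

fun tyL :: "ctx \<Rightarrow> ty \<Rightarrow> ty" where
  "tyL (CApp Hole s) T = cod T"
| "tyL (CNrec R r s Hole) T = R"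
| "tyL _ T = T"

lemma layer_headA: "layer F \<Longrightarrow> headA (fill F (Mu T c)) (Mu (tyL F T) (ssub_c 0 (cmren Suc F) c))"
  by (induction rule: layer.induct) (auto intro: headA.intros)

lemma headA_AB: "headA t t' \<Longrightarrow> redAB\<^sup>*\<^sup>* t t'"
  by (rule r_into_rtranclp, rule A_AB, rule cc_cc_c.root)
lemma headB_AB: "headB t t' \<Longrightarrow> redAB\<^sup>*\<^sup>* t t'"
  by (rule r_into_rtranclp, rule B_AB, rule cc_cc_c.root)
lemma headBc_AB: "headB_c c c' \<Longrightarrow> redAB_c\<^sup>*\<^sup>* c c'"
  by (rule r_into_rtranclp, rule Bc_ABc, rule cc_cc_c.root_c)

lemma ssub0_comp: "ssub_c 0 (cmren Suc F) (ssub_c 0 (cmren Suc G) c) = ssub_c 0 (cmren Suc (cfill F G)) c"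
  unfolding ssub_ssubS by (subst ssubS_comp) auto

lemma fillMu_layer:
  assumes F: "layer F" and E: "redAB\<^sup>*\<^sup>* (fill E (Mu T c)) (Mu T0 (ssub_c 0 (cmren Suc E) c))"
  shows "redAB\<^sup>*\<^sup>* (fill (cfill F E) (Mu T c)) (Mu (tyL F T0) (ssub_c 0 (cmren Suc (cfill F E)) c))"
proof -
  have "redAB\<^sup>*\<^sup>* (fill (cfill F E) (Mu T c)) (fill F (Mu T0 (ssub_c 0 (cmren Suc E) c)))"
    using AB_fill[OF E] by simp
  also have "redAB\<^sup>*\<^sup>* \<dots> (Mu (tyL F T0) (ssub_c 0 (cmren Suc F) (ssub_c 0 (cmren Suc E) c)))"
    by (rule headA_AB, rule layer_headA[OF F])
  finally show ?thesis by (simp add: ssub0_comp)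
qed

lemma fillMu: "\<exists>T'. redAB\<^sup>*\<^sup>* (fill E (Mu T c)) (Mu T' (ssub_c 0 (cmren Suc E) c))"
proof (induction E)
  case Hole then show ?case by (auto simp: ssub_ssubS)
next
  case (CApp E s) then show ?case using fillMu_layer[OF layer.intros(2), of E T c _ s] by auto
next
  case (CS E) then show ?case using fillMu_layer[OF layer.intros(1), of E T c] by auto
next
  case (CNrec R r s E) then show ?case using fillMu_layer[OF layer.intros(3), of E T c _ R r s] by auto
qed

text \<open>For the
  mu-eta rule this is a renaming computation; for the renaming rule [a]mu b.c, when a is
  the substituted variable, the context must first be moved inside the mu with fillMu.\<close>

lemma ssub_headB:
  assumes "headB t t'"
  shows "redAB\<^sup>*\<^sup>* (ssub k E t) (ssub k E t')"
proof -
  from assms obtain v T where t: "t = Mu T (Cmd 0 v)" "t' = mren (\<lambda>i. i - 1) v" "0 \<notin> fmv v"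
    by (auto elim: headB.cases)
  let ?E1 = "cmren Suc E"
  have "0 \<notin> fmv (ssub (Suc k) ?E1 v)"
    using t(3) fmv_ssubS(1)[of 0 "{Suc k}" ?E1 v] by (auto simp: ssub_ssubS)
  then have "headB (Mu T (Cmd 0 (ssub (Suc k) ?E1 v))) (mren (\<lambda>i. i - 1) (ssub (Suc k) ?E1 v))"
    by (rule headB.muEta)
  moreover have "mren (\<lambda>i. i - 1) (ssubS {Suc k} ?E1 v) = ssubS {k} (cmren (\<lambda>i. i - 1) ?E1) (mren (\<lambda>i. i - 1) v)"
  proof (rule mren_ssubS)
    show "\<forall>a\<in>fmv v. (a \<in> {Suc k}) = (a - 1 \<in> {k})"
    proof
      fix a assume "a \<in> fmv v" with t(3) have "a \<noteq> 0" by metis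
      then show "(a \<in> {Suc k}) = (a - 1 \<in> {k})" by (cases a) auto
    qed
  qed
  ultimately show ?thesis using t by (auto simp: ssub_ssubS intro: headB_AB)
qed

lemma ssub_headB_c:
  assumes "headB_c c c'"
  shows "redAB_c\<^sup>*\<^sup>* (ssub_c k E c) (ssub_c k E c')"
proof -
  from assms obtain a T d where c: "c = Cmd a (Mu T d)" "c' = mren_c (\<lambda>i. case i of 0 \<Rightarrow> a | Suc j \<Rightarrow> j) d"
    by (auto elim: headB_c.cases)
  let ?h = "\<lambda>i. case i of 0 \<Rightarrow> a | Suc j \<Rightarrow> j"
  let ?E1 = "cmren Suc E"
  show ?thesis
  proof (cases "a = k")
    case False
    have "headB_c (Cmd a (Mu T (ssub_c (Suc k) ?E1 d))) (mren_c ?h (ssub_c (Suc k) ?E1 d))"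
      by (rule headB_c.muRen)
    moreover have "mren_c ?h (ssubS_c {Suc k} ?E1 d) = ssubS_c {k} (cmren ?h ?E1) (mren_c ?h d)"
      by (rule mren_ssubS(2)) (use False in \<open>auto split: nat.splits\<close>)
    ultimately show ?thesis using c False by (auto simp: ssub_ssubS intro: headBc_AB)
  next
    case True
    obtain T' where fm: "redAB\<^sup>*\<^sup>* (fill E (Mu T (ssub_c (Suc k) ?E1 d))) (Mu T' (ssub_c 0 ?E1 (ssub_c (Suc k) ?E1 d)))"
      using fillMu by blast
    have "ssub_c 0 ?E1 (ssub_c (Suc k) ?E1 d) = ssubS_c ({0} \<union> {Suc k}) ?E1 d"
      unfolding ssub_ssubS by (rule ssubS_merge(2)) auto
    moreover have "mren_c ?h (ssubS_c ({0} \<union> {Suc k}) ?E1 d) = ssubS_c {k} (cmren ?h ?E1) (mren_c ?h d)"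
      by (rule mren_ssubS(2)) (use True in \<open>auto split: nat.splits\<close>)
    moreover have "headB_c (Cmd a (Mu T' (ssub_c 0 ?E1 (ssub_c (Suc k) ?E1 d)))) (mren_c ?h (ssub_c 0 ?E1 (ssub_c (Suc k) ?E1 d)))"
      by (rule headB_c.muRen)
    ultimately have "redAB_c\<^sup>*\<^sup>* (Cmd a (Mu T' (ssub_c 0 ?E1 (ssub_c (Suc k) ?E1 d)))) (ssub_c k E c')"
      using c True by (auto simp: ssub_ssubS intro: headBc_AB)
    moreover have "redAB_c\<^sup>*\<^sup>* (ssub_c k E c) (Cmd a (Mu T' (ssub_c 0 ?E1 (ssub_c (Suc k) ?E1 d))))"
      using c True AB_cmd[OF fm] by simp
    ultimately show ?thesis by (rule rtranclp_trans[rotated])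
  qed
qed

lemma B_ssub:
  "cc R Rc t t' \<Longrightarrow> R = headB \<Longrightarrow> Rc = headB_c \<Longrightarrow> redAB\<^sup>*\<^sup>* (ssub k E t) (ssub k E t')"
  "cc_c R Rc c c' \<Longrightarrow> R = headB \<Longrightarrow> Rc = headB_c \<Longrightarrow> redAB_c\<^sup>*\<^sup>* (ssub_c k E c) (ssub_c k E c')"
  by (induction arbitrary: k E and k E rule: cc_cc_c.inducts)
     (auto intro: ssub_headB ssub_headB_c AB_lam AB_appL AB_appR AB_mu AB_suc AB_nrec1 AB_nrec2
       AB_nrec3 AB_cmd AB_fill)

inductive ctx_red :: "ctx \<Rightarrow> ctx \<Rightarrow> bool" where
  "ctx_red Hole Hole"
| "ctx_red E E' \<Longrightarrow> redAB\<^sup>*\<^sup>* t t' \<Longrightarrow> ctx_red (CApp E t) (CApp E' t')"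
| "ctx_red E E' \<Longrightarrow> ctx_red (CS E) (CS E')"
| "ctx_red E E' \<Longrightarrow> redAB\<^sup>*\<^sup>* r r' \<Longrightarrow> redAB\<^sup>*\<^sup>* s s' \<Longrightarrow> ctx_red (CNrec R r s E) (CNrec R r' s' E')"

lemma ctx_red_clren: "ctx_red E E' \<Longrightarrow> ctx_red (clren f E) (clren f E')"
  by (induction rule: ctx_red.induct) (auto intro: ctx_red.intros AB_lren)
lemma ctx_red_cmren: "ctx_red E E' \<Longrightarrow> ctx_red (cmren f E) (cmren f E')"
  by (induction rule: ctx_red.induct) (auto intro: ctx_red.intros AB_mren)
lemma ctx_red_fill: "ctx_red E E' \<Longrightarrow> redAB\<^sup>*\<^sup>* u u' \<Longrightarrow> redAB\<^sup>*\<^sup>* (fill E u) (fill E' u')"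
  by (induction rule: ctx_red.induct) (auto intro: AB_app AB_suc AB_nrec)

lemma ssub_ctx_red:
  "ctx_red E E' \<Longrightarrow> redAB\<^sup>*\<^sup>* (ssub k E t) (ssub k E' t)"
  "ctx_red E E' \<Longrightarrow> redAB_c\<^sup>*\<^sup>* (ssub_c k E c) (ssub_c k E' c)"
proof (induction t and c arbitrary: k E E' and k E E')
  case (Lam T t) then show ?case by (simp add: AB_lam ctx_red_clren)
next
  case (Mu T c) then show ?case by (simp add: AB_mu ctx_red_cmren)
next
  case (Cmd a t)
  have "redAB\<^sup>*\<^sup>* (ssub k E t) (ssub k E' t)" by (rule Cmd.IH, rule Cmd.prems)
  then show ?case using Cmd.prems by (auto intro: AB_cmd ctx_red_fill)
qed (auto intro: AB_app AB_suc AB_nrec)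

text \<open>B-reduction to a numeral: prefixing the successor, an A-step followed by a B-step
  reaches the successor numeral (needed for the nrec-successor rule, which applies only
  to an argument that is literally a numeral).\<close>

lemma ssub_numeral[simp]: "ssub k E (numeral_t n) = numeral_t n"
  by (induction n) auto

lemma headB_to_numeral:
  assumes "headB x (numeral_t n)"
  shows "\<exists>u. redA (S x) u \<and> redB u (S (numeral_t n))"
proof -
  from assms obtain v T where x: "x = Mu T (Cmd 0 v)" "mren (\<lambda>i. i - 1) v = numeral_t n"
    by (auto elim: headB.cases)
  from x(2) have v: "v = numeral_t n" by (rule mren_eq_numeral)
  have "headA (S (Mu T (Cmd 0 v))) (Mu T (ssub_c 0 (CS Hole) (Cmd 0 v)))" by (rule headA.muS)
  then have "redA (S x) (Mu T (Cmd 0 (S (numeral_t n))))" using x v by (auto intro: cc_cc_c.root)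
  moreover have "headB (Mu T (Cmd 0 (S (numeral_t n)))) (mren (\<lambda>i. i - 1) (S (numeral_t n)))"
    by (rule headB.muEta) simp
  then have "redB (Mu T (Cmd 0 (S (numeral_t n)))) (S (numeral_t n))" by (auto intro: cc_cc_c.root)
  ultimately show ?thesis by blast
qed

lemma B_to_numeral: "redB x (numeral_t n) \<Longrightarrow> \<exists>u. redA (S x) u \<and> redB u (S (numeral_t n))"
proof (induction n arbitrary: x)
  case 0
  then show ?case by (cases rule: cc.cases) (use headB_to_numeral[of x 0] in auto)
next
  case (Suc n)
  from Suc.prems show ?case
  proof (cases rule: cc.cases)
    case (suc x0)
    with Suc.IH obtain u where "redA (S x0) u" "redB u (S (numeral_t n))" by auto
    with suc show ?thesis by (auto intro: cc_cc_c.suc)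
  qed (use headB_to_numeral[of x "Suc n"] in auto)
qed

text \<open>Mu-eta followed by a root A-step of a single layer F: in F[mu a.[a]v] the mu is first
  moved out of F (an A-step); then the A-step, reflected along the renaming, is performed
  under the binder, and a final mu-eta step reaches the same term.\<close>

lemma root_mueta:
  assumes F: "layer F" and v: "0 \<notin> fmv v" and h: "headA (fill F (mren (\<lambda>i. i - 1) v)) t''"
  shows "\<exists>u. redA (fill F (Mu T (Cmd 0 v))) u \<and> redAB\<^sup>*\<^sup>* u t''"
proof -
  let ?g = "\<lambda>i. i - (1::nat)"
  let ?F1 = "cmren Suc F"
  have "ssub 0 ?F1 v = v" unfolding ssub_ssubS by (rule ssubS_fresh) (use v in auto)
  then have h1: "headA (fill F (Mu T (Cmd 0 v))) (Mu (tyL F T) (Cmd 0 (fill ?F1 v)))"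
    using layer_headA[OF F, of T "Cmd 0 v"] by simp
  have "mren ?g (fill ?F1 v) = fill F (mren ?g v)" by simp
  with h obtain w where w: "headA (fill ?F1 v) w" "t'' = mren ?g w"
    using headA_reflect[of "fill F (mren ?g v)" t'' ?g "fill ?F1 v"] by auto
  have "0 \<notin> fmv w"
  proof
    assume "0 \<in> fmv w"
    then have "0 \<in> fmv (fill ?F1 v)" by (rule headA_fmv[OF w(1)])
    with v show False by auto
  qed
  then have hb: "headB (Mu (tyL F T) (Cmd 0 w)) t''" using w(2) headB.muEta[of w "tyL F T"] by simp
  have sa: "redA (Mu (tyL F T) (Cmd 0 (fill ?F1 v))) (Mu (tyL F T) (Cmd 0 w))"
    using w(1) by (auto intro: cc_cc_c.intros)
  have "redAB\<^sup>*\<^sup>* (Mu (tyL F T) (Cmd 0 (fill ?F1 v))) t''"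
    by (rule converse_rtranclp_into_rtranclp[OF A_AB[OF sa] headB_AB[OF hb]])
  moreover have "redA (fill F (Mu T (Cmd 0 v))) (Mu (tyL F T) (Cmd 0 (fill ?F1 v)))"
    using h1 by (rule cc_cc_c.root)
  ultimately show ?thesis by blast
qed

lemma headA_App_inv: "headA (App a s) t'' \<Longrightarrow> (\<exists>T w. a = Lam T w \<and> t'' = subst1 w s) \<or> (\<exists>T c. a = Mu T c \<and> t'' = Mu (cod T) (ssub_c 0 (CApp Hole (mren Suc s)) c))"
  by (auto elim: headA.cases)
lemma headA_S_inv: "headA (S a) t'' \<Longrightarrow> (\<exists>T c. a = Mu T c \<and> t'' = Mu T (ssub_c 0 (CS Hole) c))"
  by (auto elim: headA.cases)
lemma headA_Nrec_inv: "headA (Nrec R r s z) t'' \<Longrightarrow> (z = Zero \<and> t'' = r) \<or> (\<exists>n. z = S (numeral_t n) \<and> t'' = App (App s (numeral_t n)) (Nrec R r s (numeral_t n))) \<or> (\<exists>T c. z = Mu T c \<and> t'' = Mu R (ssub_c 0 (CNrec R (mren Suc r) (mren Suc s) Hole) c))"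
  by (auto elim: headA.cases)

lemma redB_inv: "redB x x' \<Longrightarrow> (\<exists>T v. x = Mu T (Cmd 0 v) \<and> x' = mren (\<lambda>i. i - 1) v \<and> 0 \<notin> fmv v)
   \<or> (\<exists>T w0 w. x = Lam T w0 \<and> x' = Lam T w \<and> redB w0 w)
   \<or> (\<exists>T c0 c. x = Mu T c0 \<and> x' = Mu T c \<and> redB_c c0 c)
   \<or> (\<exists>x0 x0'. x = S x0 \<and> x' = S x0' \<and> redB x0 x0')
   \<or> (\<exists>a b. x' = App a b) \<or> (\<exists>R a b d. x' = Nrec R a b d)"
  by (erule cc.cases) (auto elim: headB.cases)

lemma headA_A: "headA t u \<Longrightarrow> redA t u" by (rule cc_cc_c.root)

lemma B_AB_star: "redB t t' \<Longrightarrow> redAB\<^sup>*\<^sup>* t t'" by (auto intro: B_AB)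

lemma root_App_left: "redB x x' \<Longrightarrow> headA (App x' s) t'' \<Longrightarrow> \<exists>u. redA (App x s) u \<and> redAB\<^sup>*\<^sup>* u t''"
proof -
  assume B: "redB x x'" and H: "headA (App x' s) t''"
  from redB_inv[OF B] show ?thesis
  proof (elim disjE exE conjE)
    fix T v assume "x = Mu T (Cmd 0 v)" "x' = mren (\<lambda>i. i - 1) v" "0 \<notin> fmv v"
    then show ?thesis using root_mueta[of "CApp Hole s" v t'' T] H by (auto intro: layer.intros)
  next
    fix T w0 w assume x: "x = Lam T w0" "x' = Lam T w" "redB w0 w"
    with H have t'': "t'' = subst1 w s" by (auto dest: headA_App_inv)
    have "redA (App x s) (subst1 w0 s)" using x by (auto intro: headA_A headA.beta)
    moreover have "redB (subst1 w0 s) (subst1 w s)" unfolding subst1_def using x(3) by (auto intro: B_subst)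
    ultimately show ?thesis using t'' by (auto intro: B_AB)
  next
    fix T c0 c assume x: "x = Mu T c0" "x' = Mu T c" "redB_c c0 c"
    with H have t'': "t'' = Mu (cod T) (ssub_c 0 (CApp Hole (mren Suc s)) c)" by (auto dest: headA_App_inv)
    have "redA (App x s) (Mu (cod T) (ssub_c 0 (CApp Hole (mren Suc s)) c0))" using x by (auto intro: headA_A headA.muApp)
    moreover have "redAB_c\<^sup>*\<^sup>* (ssub_c 0 (CApp Hole (mren Suc s)) c0) (ssub_c 0 (CApp Hole (mren Suc s)) c)"
      using x(3) by (auto intro: B_ssub)
    ultimately show ?thesis using t'' by (auto intro: AB_mu)
  qed (use H in \<open>auto dest: headA_App_inv\<close>)
qed

lemma root_S: "redB x x' \<Longrightarrow> headA (S x') t'' \<Longrightarrow> \<exists>u. redA (S x) u \<and> redAB\<^sup>*\<^sup>* u t''"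
proof -
  assume B: "redB x x'" and H: "headA (S x') t''"
  from redB_inv[OF B] show ?thesis
  proof (elim disjE exE conjE)
    fix T v assume "x = Mu T (Cmd 0 v)" "x' = mren (\<lambda>i. i - 1) v" "0 \<notin> fmv v"
    then show ?thesis using root_mueta[of "CS Hole" v t'' T] H by (auto intro: layer.intros)
  next
    fix T c0 c assume x: "x = Mu T c0" "x' = Mu T c" "redB_c c0 c"
    with H have t'': "t'' = Mu T (ssub_c 0 (CS Hole) c)" by (auto dest: headA_S_inv)
    have "redA (S x) (Mu T (ssub_c 0 (CS Hole) c0))" using x by (auto intro: headA_A headA.muS)
    moreover have "redAB_c\<^sup>*\<^sup>* (ssub_c 0 (CS Hole) c0) (ssub_c 0 (CS Hole) c)"
      using x(3) by (auto intro: B_ssub)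
    ultimately show ?thesis using t'' by (auto intro: AB_mu)
  qed (use H in \<open>auto dest: headA_S_inv\<close>)
qed

lemma root_Nrec_arg: "redB z z' \<Longrightarrow> headA (Nrec R r s z') t'' \<Longrightarrow> \<exists>u. redA (Nrec R r s z) u \<and> redAB\<^sup>*\<^sup>* u t''"
proof -
  assume B: "redB z z'" and H: "headA (Nrec R r s z') t''"
  from redB_inv[OF B] show ?thesis
  proof (elim disjE exE conjE)
    fix T v assume "z = Mu T (Cmd 0 v)" "z' = mren (\<lambda>i. i - 1) v" "0 \<notin> fmv v"
    then show ?thesis using root_mueta[of "CNrec R r s Hole" v t'' T] H by (auto intro: layer.intros)
  next
    fix T c0 c assume x: "z = Mu T c0" "z' = Mu T c" "redB_c c0 c"
    with H have t'': "t'' = Mu R (ssub_c 0 (CNrec R (mren Suc r) (mren Suc s) Hole) c)" by (auto dest: headA_Nrec_inv)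
    have "redA (Nrec R r s z) (Mu R (ssub_c 0 (CNrec R (mren Suc r) (mren Suc s) Hole) c0))" using x by (auto intro: headA_A headA.nrecMu)
    moreover have "redAB_c\<^sup>*\<^sup>* (ssub_c 0 (CNrec R (mren Suc r) (mren Suc s) Hole) c0) (ssub_c 0 (CNrec R (mren Suc r) (mren Suc s) Hole) c)"
      using x(3) by (auto intro: B_ssub)
    ultimately show ?thesis using t'' by (auto intro: AB_mu)
  next
    fix z0 z0' assume x: "z = S z0" "z' = S z0'" "redB z0 z0'"
    with H obtain n where n: "z0' = numeral_t n" "t'' = App (App s (numeral_t n)) (Nrec R r s (numeral_t n))"
      by (auto dest: headA_Nrec_inv)
    with x B_to_numeral[of z0 n] obtain u1 where u1: "redA (S z0) u1" "redB u1 (S (numeral_t n))" by blast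
    have "redA (Nrec R r s z) (Nrec R r s u1)" using x u1 by (auto intro: cc_cc_c.nrec3)
    moreover have "redAB (Nrec R r s u1) (Nrec R r s (S (numeral_t n)))" using u1 by (auto intro: B_AB cc_cc_c.nrec3)
    moreover have "redAB\<^sup>*\<^sup>* (Nrec R r s (S (numeral_t n))) t''" using n by (auto intro: headA_AB headA.nrecS)
    ultimately show ?thesis by (meson converse_rtranclp_into_rtranclp)
  qed (use H in \<open>auto dest: headA_Nrec_inv\<close>)
qed

lemma root_App_right: "redB s s' \<Longrightarrow> headA (App x s') t'' \<Longrightarrow> \<exists>u. redA (App x s) u \<and> redAB\<^sup>*\<^sup>* u t''"
proof -
  assume B: "redB s s'" and H: "headA (App x s') t''"
  from headA_App_inv[OF H] show ?thesis
  proof (elim disjE exE conjE)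
    fix T w assume x: "x = Lam T w" "t'' = subst1 w s'"
    have "redA (App x s) (subst1 w s)" using x by (auto intro: headA_A headA.beta)
    moreover have "redAB\<^sup>*\<^sup>* (subst1 w s) (subst1 w s')" unfolding subst1_def
      by (rule AB_subst(1)) (use B in \<open>auto intro: B_AB_star split: nat.split\<close>)
    ultimately show ?thesis using x by auto
  next
    fix T c assume x: "x = Mu T c" "t'' = Mu (cod T) (ssub_c 0 (CApp Hole (mren Suc s')) c)"
    have "redA (App x s) (Mu (cod T) (ssub_c 0 (CApp Hole (mren Suc s)) c))" using x by (auto intro: headA_A headA.muApp)
    moreover have "ctx_red (CApp Hole (mren Suc s)) (CApp Hole (mren Suc s'))"
      using AB_mren[OF B_AB_star[OF B], of Suc] by (auto intro!: ctx_red.intros)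
    ultimately show ?thesis using x by (auto intro: AB_mu ssub_ctx_red)
  qed
qed

lemma root_Nrec_base: "redB r r' \<Longrightarrow> headA (Nrec R r' s z) t'' \<Longrightarrow> \<exists>u. redA (Nrec R r s z) u \<and> redAB\<^sup>*\<^sup>* u t''"
proof -
  assume B: "redB r r'" and H: "headA (Nrec R r' s z) t''"
  from headA_Nrec_inv[OF H] show ?thesis
  proof (elim disjE exE conjE)
    assume "z = Zero" "t'' = r'"
    then show ?thesis using B by (auto intro: headA_A headA.nrec0 B_AB_star)
  next
    fix n assume x: "z = S (numeral_t n)" "t'' = App (App s (numeral_t n)) (Nrec R r' s (numeral_t n))"
    have "redA (Nrec R r s z) (App (App s (numeral_t n)) (Nrec R r s (numeral_t n)))" using x by (auto intro: headA_A headA.nrecS)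
    moreover have "redAB\<^sup>*\<^sup>* (App (App s (numeral_t n)) (Nrec R r s (numeral_t n))) t''"
      using x B by (auto intro: AB_appR AB_nrec1 B_AB_star)
    ultimately show ?thesis by blast
  next
    fix T c assume x: "z = Mu T c" "t'' = Mu R (ssub_c 0 (CNrec R (mren Suc r') (mren Suc s) Hole) c)"
    have "redA (Nrec R r s z) (Mu R (ssub_c 0 (CNrec R (mren Suc r) (mren Suc s) Hole) c))" using x by (auto intro: headA_A headA.nrecMu)
    moreover have "ctx_red (CNrec R (mren Suc r) (mren Suc s) Hole) (CNrec R (mren Suc r') (mren Suc s) Hole)"
      using AB_mren[OF B_AB_star[OF B], of Suc] by (auto intro!: ctx_red.intros)
    ultimately show ?thesis using x by (auto intro: AB_mu ssub_ctx_red)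
  qed
qed

lemma root_Nrec_step: "redB s s' \<Longrightarrow> headA (Nrec R r s' z) t'' \<Longrightarrow> \<exists>u. redA (Nrec R r s z) u \<and> redAB\<^sup>*\<^sup>* u t''"
proof -
  assume B: "redB s s'" and H: "headA (Nrec R r s' z) t''"
  from headA_Nrec_inv[OF H] show ?thesis
  proof (elim disjE exE conjE)
    assume "z = Zero" "t'' = r"
    then show ?thesis by (auto intro: headA_A headA.nrec0)
  next
    fix n assume x: "z = S (numeral_t n)" "t'' = App (App s' (numeral_t n)) (Nrec R r s' (numeral_t n))"
    have "redA (Nrec R r s z) (App (App s (numeral_t n)) (Nrec R r s (numeral_t n)))" using x by (auto intro: headA_A headA.nrecS)
    moreover have "redAB\<^sup>*\<^sup>* (App (App s (numeral_t n)) (Nrec R r s (numeral_t n))) t''"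
      using x AB_app[OF AB_appL[OF B_AB_star[OF B]] AB_nrec2[OF B_AB_star[OF B]]] by auto
    ultimately show ?thesis by blast
  next
    fix T c assume x: "z = Mu T c" "t'' = Mu R (ssub_c 0 (CNrec R (mren Suc r) (mren Suc s') Hole) c)"
    have "redA (Nrec R r s z) (Mu R (ssub_c 0 (CNrec R (mren Suc r) (mren Suc s) Hole) c))" using x by (auto intro: headA_A headA.nrecMu)
    moreover have "ctx_red (CNrec R (mren Suc r) (mren Suc s) Hole) (CNrec R (mren Suc r) (mren Suc s') Hole)"
      using AB_mren[OF B_AB_star[OF B], of Suc] by (auto intro!: ctx_red.intros)
    ultimately show ?thesis using x by (auto intro: AB_mu ssub_ctx_red)
  qed
qed

lemma A_Lam_inv: "redA (Lam T a) t'' \<Longrightarrow> \<exists>a'. redA a a' \<and> t'' = Lam T a'"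
  by (erule cc.cases) (auto elim: headA.cases)
lemma A_App_inv: "redA (App a b) t'' \<Longrightarrow> headA (App a b) t'' \<or> (\<exists>a'. redA a a' \<and> t'' = App a' b) \<or> (\<exists>b'. redA b b' \<and> t'' = App a b')"
  by (erule cc.cases) auto
lemma A_Mu_inv: "redA (Mu T c) t'' \<Longrightarrow> \<exists>c'. redA_c c c' \<and> t'' = Mu T c'"
  by (erule cc.cases) (auto elim: headA.cases)
lemma A_S_inv: "redA (S a) t'' \<Longrightarrow> headA (S a) t'' \<or> (\<exists>a'. redA a a' \<and> t'' = S a')"
  by (erule cc.cases) auto
lemma A_Nrec_inv: "redA (Nrec R a b d) t'' \<Longrightarrow> headA (Nrec R a b d) t'' \<or> (\<exists>a'. redA a a' \<and> t'' = Nrec R a' b d)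
   \<or> (\<exists>b'. redA b b' \<and> t'' = Nrec R a b' d) \<or> (\<exists>d'. redA d d' \<and> t'' = Nrec R a b d')"
  by (erule cc.cases) auto
lemma Ac_Cmd_inv: "redA_c (Cmd a x) c'' \<Longrightarrow> \<exists>x'. redA x x' \<and> c'' = Cmd a x'"
  by (erule cc_c.cases) auto

text \<open>An A-step
  of the whole term is at the root (handled by the critical pairs above), inside the same
  subterm (IH), or in a disjoint subterm (the two steps are simply swapped).\<close>

lemma postpone_App_left:
  assumes B: "redB t t'" and A: "redA (App t' s) v"
    and IH: "\<And>v. redA t' v \<Longrightarrow> \<exists>u. redA t u \<and> redAB\<^sup>*\<^sup>* u v"
  shows "\<exists>u. redA (App t s) u \<and> redAB\<^sup>*\<^sup>* u v"
  using A_App_inv[OF A]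
proof (elim disjE exE conjE)
  assume "headA (App t' s) v" then show ?thesis using root_App_left B by blast
next
  fix a' assume "redA t' a'" "v = App a' s"
  with IH obtain u where "redA t u" "redAB\<^sup>*\<^sup>* u a'" by blast
  with \<open>v = App a' s\<close> show ?thesis by (auto intro: cc_cc_c.appL AB_appL)
next
  fix b' assume "redA s b'" "v = App t' b'"
  moreover have "redAB (App t b') (App t' b')" using B by (auto intro: B_AB cc_cc_c.appL)
  ultimately show ?thesis by (auto intro: cc_cc_c.appR)
qed

lemma postpone_App_right:
  assumes B: "redB s s'" and A: "redA (App t s') v"
    and IH: "\<And>v. redA s' v \<Longrightarrow> \<exists>u. redA s u \<and> redAB\<^sup>*\<^sup>* u v"
  shows "\<exists>u. redA (App t s) u \<and> redAB\<^sup>*\<^sup>* u v"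
  using A_App_inv[OF A]
proof (elim disjE exE conjE)
  assume "headA (App t s') v" then show ?thesis using root_App_right B by blast
next
  fix a' assume "redA t a'" "v = App a' s'"
  moreover have "redAB (App a' s) (App a' s')" using B by (auto intro: B_AB cc_cc_c.appR)
  ultimately show ?thesis by (auto intro: cc_cc_c.appL)
next
  fix b' assume "redA s' b'" "v = App t b'"
  with IH obtain u where "redA s u" "redAB\<^sup>*\<^sup>* u b'" by blast
  with \<open>v = App t b'\<close> show ?thesis by (auto intro: cc_cc_c.appR AB_appR)
qed

lemma postpone_S:
  assumes B: "redB t t'" and A: "redA (S t') v"
    and IH: "\<And>v. redA t' v \<Longrightarrow> \<exists>u. redA t u \<and> redAB\<^sup>*\<^sup>* u v"
  shows "\<exists>u. redA (S t) u \<and> redAB\<^sup>*\<^sup>* u v"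
  using A_S_inv[OF A]
proof (elim disjE exE conjE)
  assume "headA (S t') v" then show ?thesis using root_S B by blast
next
  fix a' assume "redA t' a'" "v = S a'"
  with IH obtain u where "redA t u" "redAB\<^sup>*\<^sup>* u a'" by blast
  with \<open>v = S a'\<close> show ?thesis by (auto intro: cc_cc_c.suc AB_suc)
qed

lemma postpone_Nrec_base:
  assumes B: "redB r r'" and A: "redA (Nrec T r' s t) v"
    and IH: "\<And>v. redA r' v \<Longrightarrow> \<exists>u. redA r u \<and> redAB\<^sup>*\<^sup>* u v"
  shows "\<exists>u. redA (Nrec T r s t) u \<and> redAB\<^sup>*\<^sup>* u v"
  using A_Nrec_inv[OF A]
proof (elim disjE exE conjE)
  assume "headA (Nrec T r' s t) v" then show ?thesis using root_Nrec_base B by blast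
next
  fix a' assume "redA r' a'" "v = Nrec T a' s t"
  with IH obtain u where "redA r u" "redAB\<^sup>*\<^sup>* u a'" by blast
  with \<open>v = Nrec T a' s t\<close> show ?thesis by (auto intro: cc_cc_c.nrec1 AB_nrec1)
next
  fix b' assume "redA s b'" "v = Nrec T r' b' t"
  moreover have "redAB (Nrec T r b' t) (Nrec T r' b' t)" using B by (auto intro: B_AB cc_cc_c.nrec1)
  ultimately show ?thesis by (auto intro: cc_cc_c.nrec2)
next
  fix d' assume "redA t d'" "v = Nrec T r' s d'"
  moreover have "redAB (Nrec T r s d') (Nrec T r' s d')" using B by (auto intro: B_AB cc_cc_c.nrec1)
  ultimately show ?thesis by (auto intro: cc_cc_c.nrec3)
qed

lemma postpone_Nrec_step:
  assumes B: "redB s s'" and A: "redA (Nrec T r s' t) v"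
    and IH: "\<And>v. redA s' v \<Longrightarrow> \<exists>u. redA s u \<and> redAB\<^sup>*\<^sup>* u v"
  shows "\<exists>u. redA (Nrec T r s t) u \<and> redAB\<^sup>*\<^sup>* u v"
  using A_Nrec_inv[OF A]
proof (elim disjE exE conjE)
  assume "headA (Nrec T r s' t) v" then show ?thesis using root_Nrec_step B by blast
next
  fix a' assume "redA r a'" "v = Nrec T a' s' t"
  moreover have "redAB (Nrec T a' s t) (Nrec T a' s' t)" using B by (auto intro: B_AB cc_cc_c.nrec2)
  ultimately show ?thesis by (auto intro: cc_cc_c.nrec1)
next
  fix b' assume "redA s' b'" "v = Nrec T r b' t"
  with IH obtain u where "redA s u" "redAB\<^sup>*\<^sup>* u b'" by blast
  with \<open>v = Nrec T r b' t\<close> show ?thesis by (auto intro: cc_cc_c.nrec2 AB_nrec2)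
next
  fix d' assume "redA t d'" "v = Nrec T r s' d'"
  moreover have "redAB (Nrec T r s d') (Nrec T r s' d')" using B by (auto intro: B_AB cc_cc_c.nrec2)
  ultimately show ?thesis by (auto intro: cc_cc_c.nrec3)
qed

lemma postpone_Nrec_arg:
  assumes B: "redB t t'" and A: "redA (Nrec T r s t') v"
    and IH: "\<And>v. redA t' v \<Longrightarrow> \<exists>u. redA t u \<and> redAB\<^sup>*\<^sup>* u v"
  shows "\<exists>u. redA (Nrec T r s t) u \<and> redAB\<^sup>*\<^sup>* u v"
  using A_Nrec_inv[OF A]
proof (elim disjE exE conjE)
  assume "headA (Nrec T r s t') v" then show ?thesis using root_Nrec_arg B by blast
next
  fix a' assume "redA r a'" "v = Nrec T a' s t'"
  moreover have "redAB (Nrec T a' s t) (Nrec T a' s t')" using B by (auto intro: B_AB cc_cc_c.nrec3)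
  ultimately show ?thesis by (auto intro: cc_cc_c.nrec1)
next
  fix b' assume "redA s b'" "v = Nrec T r b' t'"
  moreover have "redAB (Nrec T r b' t) (Nrec T r b' t')" using B by (auto intro: B_AB cc_cc_c.nrec3)
  ultimately show ?thesis by (auto intro: cc_cc_c.nrec2)
next
  fix d' assume "redA t' d'" "v = Nrec T r s d'"
  with IH obtain u where "redA t u" "redAB\<^sup>*\<^sup>* u d'" by blast
  with \<open>v = Nrec T r s d'\<close> show ?thesis by (auto intro: cc_cc_c.nrec3 AB_nrec3)
qed

text \<open>Postponement at the root of a B-redex: after mu-eta, the A-step is reflected along the
  renaming and performed under the binder; after [a]mu b.c likewise.\<close>

lemma postpone_headB:
  assumes B: "headB t t'" and A: "redA t' v"
  shows "\<exists>u. redA t u \<and> redAB\<^sup>*\<^sup>* u v"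
proof -
  from B obtain w T where t: "t = Mu T (Cmd 0 w)" "t' = mren (\<lambda>i. i - 1) w" "0 \<notin> fmv w"
    by (auto elim: headB.cases)
  obtain w' where w': "redA w w'" "v = mren (\<lambda>i. i - 1) w'"
    using A_reflect(1)[OF A refl refl, of "\<lambda>i. i - 1" w] t by auto
  have "0 \<notin> fmv w'" using t(3) A_fmv(1)[OF w'(1)] by blast
  then have "headB (Mu T (Cmd 0 w')) v" using w'(2) headB.muEta[of w' T] by simp
  moreover have "redA t (Mu T (Cmd 0 w'))" using t w' by (auto intro: cc_cc_c.intros)
  ultimately show ?thesis by (blast intro: headB_AB)
qed

lemma postpone_headB_c:
  assumes B: "headB_c c c'" and A: "redA_c c' d"
  shows "\<exists>u. redA_c c u \<and> redAB_c\<^sup>*\<^sup>* u d"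
proof -
  from B obtain a T e where c: "c = Cmd a (Mu T e)" "c' = mren_c (\<lambda>i. case i of 0 \<Rightarrow> a | Suc j \<Rightarrow> j) e"
    by (auto elim: headB_c.cases)
  obtain e' where e': "redA_c e e'" "d = mren_c (\<lambda>i. case i of 0 \<Rightarrow> a | Suc j \<Rightarrow> j) e'"
    using A_reflect(2)[OF A refl refl, of "\<lambda>i. case i of 0 \<Rightarrow> a | Suc j \<Rightarrow> j" e] c by auto
  have "headB_c (Cmd a (Mu T e')) d" using e'(2) by (simp add: headB_c.muRen)
  moreover have "redA_c c (Cmd a (Mu T e'))" using c e' by (auto intro: cc_cc_c.intros)
  ultimately show ?thesis by (blast intro: headBc_AB)
qed

lemma postpone_B:
  "cc R Rc t t' \<Longrightarrow> R = headB \<Longrightarrow> Rc = headB_c \<Longrightarrow> redA t' v \<Longrightarrow> \<exists>u. redA t u \<and> redAB\<^sup>*\<^sup>* u v"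
  "cc_c R Rc c c' \<Longrightarrow> R = headB \<Longrightarrow> Rc = headB_c \<Longrightarrow> redA_c c' d \<Longrightarrow> \<exists>u. redA_c c u \<and> redAB_c\<^sup>*\<^sup>* u d"
proof (induction arbitrary: v and d rule: cc_cc_c.inducts)
  case (lam t t' T)
  then obtain a' where "redA t' a'" "v = Lam T a'" by (auto dest: A_Lam_inv)
  with lam obtain u where "redA t u" "redAB\<^sup>*\<^sup>* u a'" by blast
  with \<open>v = Lam T a'\<close> show ?case by (auto intro: cc_cc_c.lam AB_lam)
next
  case (mu c c' T)
  then obtain d where "redA_c c' d" "v = Mu T d" by (auto dest: A_Mu_inv)
  with mu obtain u where "redA_c c u" "redAB_c\<^sup>*\<^sup>* u d" by blast
  with \<open>v = Mu T d\<close> show ?case by (auto intro: cc_cc_c.mu AB_mu)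
next
  case (cmd t t' a)
  then obtain x where "redA t' x" "d = Cmd a x" by (auto dest: Ac_Cmd_inv)
  with cmd obtain u where "redA t u" "redAB\<^sup>*\<^sup>* u x" by blast
  with \<open>d = Cmd a x\<close> show ?case by (auto intro: cc_cc_c.cmd AB_cmd)
qed (auto intro: postpone_headB postpone_headB_c postpone_App_left postpone_App_right postpone_S
  postpone_Nrec_base postpone_Nrec_step postpone_Nrec_arg)

theorem mainTheorem17:
  shows "SN stepA t \<Longrightarrow> SN stepAB t"
  unfolding stepA_def stepAB_def
proof (rule SN_postponement)
  show "redA x y \<or> redB x y" if "redAB x y" for x y
    using AB_cases(1)[OF that refl refl] .
  show "size y < size x" if "redB x y" for x y
    using B_size(1)[OF that refl refl] .
  show "\<exists>w. redA x w \<and> redAB\<^sup>*\<^sup>* w z" if "redB x y" "redA y z" for x y z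
    using postpone_B(1)[OF that(1) refl refl that(2)] .
qed

end
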